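(* For every $n\ge 2$ there is a constant $K>0$ depending only on $n$ such that the following holds. Let $\mathcal G=(V,E)$ be a connected, non-bipartite undirected graph with $V=[n]$, let $X_1,\dots,X_n$ be pairwise distinct real numbers with ranks $r_1,\dots,r_n$, and let $R_k(t)$ be the Asynchronous GoRank estimates defined in the context. Then for every $k\in[n]$ and every integer $t\ge 1$, $$\mathbb E\big[\,|R_k(t)-r_k|\,\big]\;\le\;\frac{K}{\sqrt{ct}}\cdot\sigma_n(r_k),$$ where $c$ is the second smallest eigenvalue of $\mathbf L(P)=\sum_{e\in E}p_e\mathbf L_e$, $\sigma_n(r_k)=n^{3/2}\,\phi\big((r_k-1)/n\big)$ and $\phi(u)=\sqrt{u(1-u)}$.
   Context: Graph and edge sampling: $\mathcal G=(V,E)$ is a connected, non-bipartite undirected graph on $V=[n]=\{1,\dots,n\}$, $n\ge2$; $d_i$ is the degree of node $i$. Node $k$ holds the (fixed) real number $X_k$, with no ties. Edges $e_0,e_1,e_2,\dots$ are drawn i.i.d. from $E$, with edge $e=(i,j)$ having probability $p_e=\frac1n\left(\frac1{d_i}+\frac1{d_j}\right)$. For $e=(i,j)$ let $\mathbf L_e=(\mathbf e_i-\mathbf e_j)(\mathbf e_i-\mathbf e_j)^\top$, where $\mathbf e_1,\dots,\mathbf e_n$ is the canonical basis of $\mathbb R^n$. Ranks: $r_k=1+\sum_{l=1}^n\mathbb I_{\{X_k>X_l\}}$. Asynchronous GoRank: each node $k$ has an auxiliary observation $Y_k$, initially $X_k$. At step $s=0,1,2,\dots$ the edge $e_s=(i,j)$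 is drawn; each of the two nodes $k\in\{i,j\}$ updates its running average of the indicators $\mathbb I_{\{X_k>Y_k\}}$ computed with its current auxiliary observation; then $Y_i$ and $Y_j$ are swapped. Explicitly, let $\mathbf W_1(s)=\mathbf I_n-\mathbf L_{e_s}$ (a permutation matrix), $\mathbf W_1(s{:})=\mathbf W_1(s)\mathbf W_1(s-1)\cdots\mathbf W_1(0)$, $\mathbf h_k=(\mathbb I_{\{X_k>X_1\}},\dots,\mathbb I_{\{X_k>X_n\}})^\top$, $\delta_k(s)=1$ if $k$ is an endpoint of $e_s$ and $\delta_k(s)=0$ otherwise, and $C_k(t)=\sum_{s=1}^t\delta_k(s)$. For $t\ge1$ the estimate of $r_k$ is $$R_k(t)=1+n\cdot\frac1{C_k(t)}\sum_{s=1}^t\delta_k(s)\,\mathbf h_k^\top\mathbf W_1(s{-}1{:})^\top\mathbf e_k ,$$ with $R_k(t)=1$ (the initial value) when $C_k(t)=0$. *)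

theory Defs
  imports "HOL-Probability.Probability" "Jordan_Normal_Form.Char_Poly"
begin

unbundle no vec_syntax
unbundle no inner_syntax

hide_const (open) Finite_Cartesian_Product.vec Finite_Cartesian_Product.mat

text \<open>The nodes are \<open>0, \<dots>, n - 1\<close> instead of \<open>1, \<dots>, n\<close>, in line with the indices of
  \<^typ>\<open>real vec\<close> and \<^typ>\<open>real mat\<close>. An undirected edge is stored once, as the pair \<open>(i, j)\<close> of
  its endpoints with \<open>i < j\<close>, so that a set of such pairs is exactly a simple undirected graph.\<close>

type_synonym edge = "nat \<times> nat"

definition simple_graph :: "nat \<Rightarrow> edge set \<Rightarrow> bool" where
  "simple_graph n E \<longleftrightarrow> E \<subseteq> {(i, j). i < j \<and> j < n}"

definition adjacency :: "edge set \<Rightarrow> (nat \<times> nat) set" where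
  "adjacency E = {(i, j). (i, j) \<in> E \<or> (j, i) \<in> E}"

definition connected_graph :: "nat \<Rightarrow> edge set \<Rightarrow> bool" where
  "connected_graph n E \<longleftrightarrow> (\<forall>i<n. \<forall>j<n. (i, j) \<in> (adjacency E)\<^sup>*)"

definition bipartite_graph :: "nat \<Rightarrow> edge set \<Rightarrow> bool" where
  "bipartite_graph n E \<longleftrightarrow>
     (\<exists>A B. A \<union> B = {..<n} \<and> A \<inter> B = {} \<and> adjacency E \<subseteq> A \<times> B \<union> B \<times> A)"

definition endpoint :: "nat \<Rightarrow> edge \<Rightarrow> bool" where
  "endpoint k e \<longleftrightarrow> k = fst e \<or> k = snd e"

definition degree_of :: "edge set \<Rightarrow> nat \<Rightarrow> nat" where
  "degree_of E i = card {e \<in> E. endpoint i e}"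

definition edge_prob :: "nat \<Rightarrow> edge set \<Rightarrow> edge \<Rightarrow> real" where
  "edge_prob n E = (\<lambda>(i, j). 1 / real n * (1 / real (degree_of E i) + 1 / real (degree_of E j)))"

definition edge_pmf :: "nat \<Rightarrow> edge set \<Rightarrow> edge pmf" where
  "edge_pmf n E = embed_pmf (\<lambda>e. if e \<in> E then edge_prob n E e else 0)"

text \<open>The law of the sequence \<open>e\<^sub>0, e\<^sub>1, e\<^sub>2, \<dots>\<close> of i.i.d. edges.\<close>

definition edge_seq :: "nat \<Rightarrow> edge set \<Rightarrow> (nat \<Rightarrow> edge) measure" where
  "edge_seq n E = PiM UNIV (\<lambda>_. measure_pmf (edge_pmf n E))"

definition edge_laplacian :: "nat \<Rightarrow> edge \<Rightarrow> real mat" where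
  "edge_laplacian n = (\<lambda>(i, j).
     let v = unit_vec n i - unit_vec n j in mat n n (\<lambda>(a, b). v $ a * v $ b))"

definition weighted_laplacian :: "nat \<Rightarrow> edge set \<Rightarrow> real mat" where
  "weighted_laplacian n E =
     mat n n (\<lambda>(a, b). \<Sum>e\<in>E. edge_prob n E e * edge_laplacian n e $$ (a, b))"

text \<open>Eigenvalues are listed in increasing order and counted with algebraic multiplicity.\<close>

definition second_smallest_eigenvalue :: "real mat \<Rightarrow> real" where
  "second_smallest_eigenvalue A = sorted_list_of_multiset (proots (char_poly A)) ! 1"

text \<open>The argument \<open>\<omega>\<close> below is the sequence of drawn edges.\<close>

definition swap_mat :: "nat \<Rightarrow> (nat \<Rightarrow> edge) \<Rightarrow> nat \<Rightarrow> real mat" where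
  "swap_mat n \<omega> s = 1\<^sub>m n - edge_laplacian n (\<omega> s)"

primrec swap_mat_prod :: "nat \<Rightarrow> (nat \<Rightarrow> edge) \<Rightarrow> nat \<Rightarrow> real mat" where
  "swap_mat_prod n \<omega> 0 = swap_mat n \<omega> 0"
| "swap_mat_prod n \<omega> (Suc s) = swap_mat n \<omega> (Suc s) * swap_mat_prod n \<omega> s"

definition rank_of :: "nat \<Rightarrow> (nat \<Rightarrow> real) \<Rightarrow> nat \<Rightarrow> real" where
  "rank_of n X k = 1 + (\<Sum>l<n. of_bool (X k > X l))"

definition hvec :: "nat \<Rightarrow> (nat \<Rightarrow> real) \<Rightarrow> nat \<Rightarrow> real vec" where
  "hvec n X k = vec n (\<lambda>l. of_bool (X k > X l))"

definition active :: "(nat \<Rightarrow> edge) \<Rightarrow> nat \<Rightarrow> nat \<Rightarrow> real" where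
  "active \<omega> k s = of_bool (endpoint k (\<omega> s))"

definition active_count :: "(nat \<Rightarrow> edge) \<Rightarrow> nat \<Rightarrow> nat \<Rightarrow> real" where
  "active_count \<omega> k t = (\<Sum>s=1..t. active \<omega> k s)"

definition gorank :: "nat \<Rightarrow> (nat \<Rightarrow> real) \<Rightarrow> (nat \<Rightarrow> edge) \<Rightarrow> nat \<Rightarrow> nat \<Rightarrow> real" where
  "gorank n X \<omega> k t =
     (if active_count \<omega> k t = 0 then 1
      else 1 + real n * (1 / active_count \<omega> k t *
        (\<Sum>s=1..t. active \<omega> k s *
           (hvec n X k \<bullet> (transpose_mat (swap_mat_prod n \<omega> (s - 1)) *\<^sub>v unit_vec n k)))))"

definition phi :: "real \<Rightarrow> real" where
  "phi u = sqrt (u * (1 - u))"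

definition sigma_n :: "nat \<Rightarrow> real \<Rightarrow> real" where
  "sigma_n n r = real n powr (3 / 2) * phi ((r - 1) / real n)"

text \<open>The edge weights form a probability distribution on the edges of a connected graph, so that
  \<open>embed_pmf\<close> is used within its domain.\<close>

lemma finite_simple_graph:
  assumes "simple_graph n E"
  shows "finite E"
proof (rule finite_subset)
  show "E \<subseteq> {..<n} \<times> {..<n}" using assms by (auto simp: simple_graph_def)
qed simp

lemma degree_of_pos:
  assumes "simple_graph n E" "connected_graph n E" "n \<ge> 2" "i < n"
  shows "degree_of E i > 0"
proof -
  define j where "j = (if i = 0 then 1 else 0 :: nat)"
  have "j < n" "j \<noteq> i" using assms by (auto simp: j_def)
  then have "(i, j) \<in> (adjacency E)\<^sup>*" using assms by (auto simp: connected_graph_def)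
  with \<open>j \<noteq> i\<close> obtain u where "(i, u) \<in> adjacency E" by (metis converse_rtranclE)
  then have "{e \<in> E. endpoint i e} \<noteq> {}"
    by (auto simp: adjacency_def endpoint_def)
  moreover have "finite E"
    using assms(1) by (rule finite_simple_graph)
  ultimately show ?thesis by (simp add: degree_of_def card_gt_0_iff)
qed

lemma sum_edge_prob:
  assumes "simple_graph n E" "connected_graph n E" "n \<ge> 2"
  shows "(\<Sum>e\<in>E. edge_prob n E e) = 1"
proof -
  have fin: "finite E"
    using assms(1) by (rule finite_simple_graph)
  have "edge_prob n E e = (\<Sum>i<n. if endpoint i e then 1 / real n * (1 / real (degree_of E i)) else 0)"
    if eE: "e \<in> E" for e
  proof -
    obtain i j where e: "e = (i, j)" "i < j" "j < n"
      using eE assms(1) unfolding simple_graph_def by blast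
    have "(\<Sum>l<n. if endpoint l e then 1 / real n * (1 / real (degree_of E l)) else 0) =
        (\<Sum>l\<in>{i, j}. 1 / real n * (1 / real (degree_of E l)))"
      using e by (intro sum.mono_neutral_cong_right) (auto simp: endpoint_def)
    then show ?thesis using e by (simp add: edge_prob_def algebra_simps)
  qed
  then have "(\<Sum>e\<in>E. edge_prob n E e) =
      (\<Sum>e\<in>E. \<Sum>i<n. if endpoint i e then 1 / real n * (1 / real (degree_of E i)) else 0)"
    by (rule sum.cong[OF refl])
  also have "\<dots> = (\<Sum>i<n. \<Sum>e\<in>E. if endpoint i e then 1 / real n * (1 / real (degree_of E i)) else 0)"
    by (rule sum.swap)
  also have "\<dots> = (\<Sum>i<n. 1 / real n)"
  proof (rule sum.cong[OF refl])
    fix i assume "i \<in> {..<n}"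
    then have "degree_of E i > 0" using degree_of_pos[OF assms] by simp
    moreover have "(\<Sum>e\<in>E. if endpoint i e then 1 / real n * (1 / real (degree_of E i)) else 0) =
        real (degree_of E i) * (1 / real n * (1 / real (degree_of E i)))"
      by (subst sum.inter_filter[OF fin, symmetric]) (simp add: degree_of_def)
    ultimately show "(\<Sum>e\<in>E. if endpoint i e then 1 / real n * (1 / real (degree_of E i)) else 0) =
        1 / real n" by simp
  qed
  also have "\<dots> = 1" using assms by simp
  finally show ?thesis .
qed

lemma pmf_edge_pmf:
  assumes "simple_graph n E" "connected_graph n E" "n \<ge> 2"
  shows "pmf (edge_pmf n E) e = (if e \<in> E then edge_prob n E e else 0)"
  unfolding edge_pmf_def
proof (rule pmf_embed_pmf)
  let ?f = "\<lambda>e. if e \<in> E then edge_prob n E e else 0"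
  have fin: "finite E"
    using assms(1) by (rule finite_simple_graph)
  show nonneg: "0 \<le> ?f x" for x
    by (auto simp: edge_prob_def split: prod.split)
  have "(\<integral>\<^sup>+x. ennreal (?f x) \<partial>count_space UNIV) = (\<Sum>x\<in>E. ennreal (?f x))"
    using fin by (intro nn_integral_count_space') auto
  also have "\<dots> = ennreal (\<Sum>x\<in>E. ?f x)"
    by (intro sum_ennreal nonneg)
  also have "\<dots> = 1"
    using sum_edge_prob[OF assms] by simp
  finally show "(\<integral>\<^sup>+x. ennreal (?f x) \<partial>count_space UNIV) = 1" .
qed

end

theory Submission
  imports Defs "Jordan_Normal_Form.Schur_Decomposition"
begin

text \<open>For fixed \<open>n\<close> there are only finitely many graphs, and \<open>c > 0\<close> on each of them; moreover
  \<open>\<sigma>\<^sub>n(r\<^sub>k) \<ge> 1\<close> unless \<open>r\<^sub>k = 1\<close>, in which case the estimate is exact. So it suffices to bound the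
  expected error by \<open>D / \<surd>t\<close> for each graph and node, uniformly in \<open>X\<close>.

  With \<open>g\<close> the centred indicators, the error is \<open>n S / C\<close>, where \<open>S = \<Sum>\<^sub>s \<delta>\<^sub>k(s) Z\<^sub>s(k)\<close> and \<open>Z\<^sub>s\<close> is
  \<open>g\<close> carried along by the swaps. Let \<open>w\<close> solve the Poisson equation \<open>L(P) w = e\<^sub>k - 1/n\<close>. Then
  \<open>Z\<^sub>s(k) = w \<bullet> Z\<^sub>s - E[w \<bullet> Z\<^sub>s\<^sub>+\<^sub>1 | Z\<^sub>s]\<close>, so \<open>S\<close> is a bounded telescoping term plus a sum of bounded
  martingale differences, and \<open>E S\<^sup>2 = O(t)\<close>. No spectral gap at \<open>-1\<close> is needed. The variance of the
  activation count \<open>C\<close> is \<open>O(t)\<close> as well, which controls the event that \<open>C\<close> is small.\<close>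

subsection \<open>Symmetric real matrices\<close>

text \<open>For an eigenvector \<open>v\<close>, the Hermitian form \<open>q\<close> equals
  \<open>a\<close> times the squared norm \<open>N\<close>. Symmetry makes \<open>q\<close> its own
  conjugate, and \<open>N > 0\<close> transfers this to \<open>a\<close>.\<close>

lemma symmetric_real_eigenvalues:
  fixes A :: "real mat"
  assumes A: "A \<in> carrier_mat n n" and sym: "transpose_mat A = A"
    and ev: "eigenvalue (map_mat complex_of_real A) a"
  shows "a \<in> \<real>"
proof -
  let ?A = "map_mat complex_of_real A"
  obtain v where v: "v \<in> carrier_vec n" "v \<noteq> 0\<^sub>v n" "?A *\<^sub>v v = a \<cdot>\<^sub>v v"
    using ev A by (auto simp: eigenvalue_def eigenvector_def)
  have Asym: "A $$ (j, i) = A $$ (i, j)" if "i < n" "j < n" for i j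
    using that A arg_cong[OF sym, of "\<lambda>M. M $$ (i, j)"] by simp
  define q where "q = (\<Sum>i<n. \<Sum>j<n. cnj (v $ i) * of_real (A $$ (i, j)) * v $ j)"
  define N where "N = (\<Sum>i<n. (cmod (v $ i))\<^sup>2)"
  have "(?A *\<^sub>v v) $ i = (\<Sum>j<n. of_real (A $$ (i, j)) * v $ j)" if "i < n" for i
    using that A v(1) by (auto simp: scalar_prod_def lessThan_atLeast0 intro!: sum.cong)
  then have row: "(\<Sum>j<n. of_real (A $$ (i, j)) * v $ j) = a * v $ i" if "i < n" for i
    using that v by simp
  have "q = (\<Sum>i<n. cnj (v $ i) * (a * v $ i))"
    unfolding q_def using row by (intro sum.cong) (auto simp: mult.assoc simp flip: sum_distrib_left)
  also have "\<dots> = a * of_real N"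
    by (simp add: N_def sum_distrib_left complex_norm_square mult_ac del: of_real_power)
  finally have q: "q = a * of_real N" .
  have "cnj q = (\<Sum>i<n. \<Sum>j<n. v $ i * of_real (A $$ (i, j)) * cnj (v $ j))"
    by (simp add: q_def)
  also have "\<dots> = (\<Sum>j<n. \<Sum>i<n. v $ i * of_real (A $$ (i, j)) * cnj (v $ j))"
    by (rule sum.swap)
  also have "\<dots> = q"
    unfolding q_def by (intro sum.cong refl) (simp add: Asym mult_ac)
  finally have "cnj q = q" .
  obtain i where i: "i < n" "v $ i \<noteq> 0"
    using v by (metis carrier_vecD eq_vecI index_zero_vec)
  have "N > 0"
    unfolding N_def using i by (intro sum_pos2[of _ i]) auto
  with q \<open>cnj q = q\<close> have "cnj a = a" by auto
  then show ?thesis by (simp add: Reals_cnj_iff)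
qed

text \<open>Over the complex numbers the polynomial splits; all roots are real, and the embedding of
  real polynomials is injective, so the factorization descends.\<close>

lemma symmetric_real_char_poly_splits:
  fixes A :: "real mat"
  assumes A: "A \<in> carrier_mat n n" and sym: "transpose_mat A = A"
  obtains bs where "char_poly A = (\<Prod>b\<leftarrow>bs. [:- b, 1:])" "length bs = n"
proof -
  let ?A = "map_mat complex_of_real A"
  have cA: "?A \<in> carrier_mat n n" using A by simp
  obtain as where as: "char_poly ?A = (\<Prod>a\<leftarrow>as. [:- a, 1:])" "length as = n"
    using char_poly_factorized[OF cA] by blast
  have real: "a \<in> \<real>" if "a \<in> set as" for a
  proof -
    have "poly (char_poly ?A) a = 0"
      using that unfolding as(1) by (rule linear_poly_root)
    then show ?thesis
      using symmetric_real_eigenvalues[OF A sym] eigenvalue_root_char_poly[OF cA] by blast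
  qed
  interpret h: map_poly_inj_idom_hom complex_of_real ..
  define bs where "bs = map Re as"
  have "as = map of_real bs"
    unfolding bs_def using real by (auto simp: list_eq_iff_nth_eq of_real_Re)
  have "map_poly complex_of_real (char_poly A) = char_poly ?A"
    by (rule of_real_hom.char_poly_hom[OF A, symmetric])
  also have "\<dots> = map_poly complex_of_real (\<Prod>b\<leftarrow>bs. [:- b, 1:])"
    unfolding as(1) \<open>as = map of_real bs\<close>
    by (induction bs) (simp_all only: list.map prod_list.Nil prod_list.Cons h.hom_one h.hom_mult, simp)
  finally have "char_poly A = (\<Prod>b\<leftarrow>bs. [:- b, 1:])"
    by simp
  moreover have "length bs = n" by (simp add: bs_def as(2))
  ultimately show ?thesis by (rule that)
qed

section \<open>Positivity of the second smallest eigenvalue\<close>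

lemma proots_prod_linear: "proots (\<Prod>b\<leftarrow>bs. [:- b, 1:]) = mset (bs :: real list)"
proof (induction bs)
  case (Cons b bs)
  have "(\<Prod>b\<leftarrow>bs. [:- b, 1:]) \<noteq> (0 :: real poly)"
    by (auto simp: prod_list_zero_iff)
  then have "proots ([:- b, 1:] * (\<Prod>b\<leftarrow>bs. [:- b, 1:])) = proots [:- b, 1:] + proots (\<Prod>b\<leftarrow>bs. [:- b, 1:])"
    by (intro proots_mult) auto
  then show ?case using Cons by (simp only: list.map prod_list.Cons) simp
qed simp

lemma scalar_prod_self_pos:
  fixes v :: "real vec"
  assumes "v \<in> carrier_vec n" "v \<noteq> 0\<^sub>v n"
  shows "v \<bullet> v > 0"
proof -
  obtain i where "i < n" "v $ i \<noteq> 0"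
    using assms by (metis carrier_vecD eq_vecI index_zero_vec)
  then show ?thesis
    using assms unfolding scalar_prod_def by (intro sum_pos2[of _ i]) auto
qed

text \<open>Eigenvalues are counted algebraically, so a double eigenvalue 0 only yields a Jordan chain
  \<open>A p\<^sub>1 = b p\<^sub>0\<close>, \<open>A p\<^sub>0 = 0\<close>; symmetry gives \<open>\<parallel>A p\<^sub>1\<parallel>\<^sup>2 = p\<^sub>1 \<bullet> A\<^sup>2 p\<^sub>1 = 0\<close>.\<close>

lemma second_smallest_eigenvalue_pos:
  fixes A :: "real mat"
  assumes A: "A \<in> carrier_mat n n" and sym: "transpose_mat A = A" and n: "n \<ge> 2"
    and psd: "\<And>v. v \<in> carrier_vec n \<Longrightarrow> v \<bullet> (A *\<^sub>v v) \<ge> 0"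
    and ker: "\<And>u v. u \<in> carrier_vec n \<Longrightarrow> v \<in> carrier_vec n \<Longrightarrow> u \<noteq> 0\<^sub>v n \<Longrightarrow>
      A *\<^sub>v u = 0\<^sub>v n \<Longrightarrow> A *\<^sub>v v = 0\<^sub>v n \<Longrightarrow> \<exists>c. v = c \<cdot>\<^sub>v u"
  shows "second_smallest_eigenvalue A > 0"
proof -
  obtain bs where bs: "char_poly A = (\<Prod>b\<leftarrow>bs. [:- b, 1:])" "length bs = n"
    using symmetric_real_char_poly_splits[OF A sym] by blast
  define es where "es = sort bs"
  have len: "length es = n" by (simp add: es_def bs)
  have second: "second_smallest_eigenvalue A = es ! 1"
    by (simp add: second_smallest_eigenvalue_def bs(1) proots_prod_linear es_def)
  have cp: "char_poly A = (\<Prod>b\<leftarrow>es. [:- b, 1:])"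
    unfolding bs(1) prod_mset_prod_list[symmetric] by (simp add: es_def)
  have nonneg: "e \<ge> 0" if "e \<in> set es" for e
  proof -
    have "poly (char_poly A) e = 0"
      using that unfolding cp by (rule linear_poly_root)
    then obtain v where v: "v \<in> carrier_vec n" "v \<noteq> 0\<^sub>v n" "A *\<^sub>v v = e \<cdot>\<^sub>v v"
      using A by (auto simp: eigenvalue_def eigenvector_def simp flip: eigenvalue_root_char_poly[OF A])
    have "e * (v \<bullet> v) \<ge> 0" using psd[OF v(1)] v by simp
    then show ?thesis
      using scalar_prod_self_pos[OF v(1,2)] by (simp add: zero_le_mult_iff)
  qed
  show ?thesis
  proof (rule ccontr)
    \<comment> \<open>Semidefiniteness makes all entries of \<open>es\<close> nonnegative, so a
      nonpositive second entry forces the first two to be 0.\<close>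
    assume "\<not> ?thesis"
    then have es1: "es ! 1 = 0" using second nonneg[of "es ! 1"] len n by force
    moreover have "es ! 0 \<le> es ! 1"
      using len n by (intro sorted_nth_mono) (auto simp: es_def)
    ultimately have es0: "es ! 0 = 0" using es1 nonneg[of "es ! 0"] len n nth_mem[of 0 es] by simp
    \<comment> \<open>The Schur form carries the eigenvalues on its diagonal in the order of
      \<open>es\<close>, so the leading 2 by 2 block of \<open>B\<close> is strictly upper
      triangular. The first two columns of \<open>P\<close> are the chain.\<close>
    obtain B P Q where "schur_decomposition A es = (B, P, Q)" by (metis prod_cases3)
    from schur_decomposition[OF A cp this]
    have wit: "similar_mat_wit A B P Q" and ut: "upper_triangular B" and dg: "diag_mat B = es"
      by auto
    note w = similar_mat_witD2[OF A wit]
    have B: "B \<in> carrier_mat n n" and P: "P \<in> carrier_mat n n" and Q: "Q \<in> carrier_mat n n"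
      using w by auto
    have B00: "B $$ (0, 0) = 0" using es0 dg B n by (auto simp: diag_mat_def)
    have B11: "B $$ (1, 1) = 0" using es1 dg B n by (auto simp: diag_mat_def)
    have Bl: "B $$ (i, j) = 0" if "j < i" "i < n" for i j
      using ut that B by auto
    have "A * P = P * B * (Q * P)" using w by (simp add: assoc_mult_mat[of _ n n _ n _ n])
    then have AP: "A * P = P * B" using w by simp
    define p0 where "p0 = col P 0"
    define p1 where "p1 = col P 1"
    have p0: "p0 \<in> carrier_vec n" and p1: "p1 \<in> carrier_vec n" using P by (auto simp: p0_def p1_def)
    have colB: "A *\<^sub>v col P j = P *\<^sub>v col B j" if "j < n" for j
    proof -
      have "col (A * P) j = A *\<^sub>v col P j" using that A P by (intro eq_vecI) auto
      moreover have "col (P * B) j = P *\<^sub>v col B j" using that P B by (intro eq_vecI) auto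
      ultimately show ?thesis using AP by simp
    qed
    have "col B 0 = 0\<^sub>v n" using B00 Bl B n by (intro eq_vecI) (auto, metis neq0_conv)
    then have Ap0: "A *\<^sub>v p0 = 0\<^sub>v n" using colB[of 0] n P by (auto simp: p0_def intro!: eq_vecI)
    have "col B 1 = B $$ (0, 1) \<cdot>\<^sub>v unit_vec n 0"
    proof (rule eq_vecI)
      fix i assume "i < dim_vec (B $$ (0, 1) \<cdot>\<^sub>v unit_vec n 0 :: real vec)"
      then have "i < n" by simp
      then show "col B 1 $ i = (B $$ (0, 1) \<cdot>\<^sub>v unit_vec n 0) $ i"
        using Bl[of 1 i] B11 B n by (cases "i = 0"; cases "i = 1") auto
    qed (use B in auto)
    then have "A *\<^sub>v p1 = P *\<^sub>v (B $$ (0, 1) \<cdot>\<^sub>v unit_vec n 0)" using colB[of 1] n by (simp add: p1_def)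
    also have "\<dots> = B $$ (0, 1) \<cdot>\<^sub>v p0"
    proof -
      have "P *\<^sub>v unit_vec n 0 = p0"
        using P n by (intro eq_vecI) (auto simp: p0_def)
      then show ?thesis using mult_mat_vec[OF P, of "unit_vec n 0"] by simp
    qed
    finally have Ap1: "A *\<^sub>v p1 = B $$ (0, 1) \<cdot>\<^sub>v p0" .
    have "A *\<^sub>v (A *\<^sub>v p1) = 0\<^sub>v n"
      unfolding Ap1 mult_mat_vec[OF A p0] Ap0 by (intro eq_vecI) auto
    then have "p1 \<bullet> (A *\<^sub>v (A *\<^sub>v p1)) = 0" using p1 by simp
    moreover have "p1 \<bullet> (A *\<^sub>v (A *\<^sub>v p1)) = (transpose_mat A *\<^sub>v p1) \<bullet> (A *\<^sub>v p1)"
      using transpose_vec_mult_scalar[OF A _ p1, of "A *\<^sub>v p1"] A p1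
      by (simp add: comm_scalar_prod[of _ n])
    ultimately have "(A *\<^sub>v p1) \<bullet> (A *\<^sub>v p1) = 0" unfolding sym by simp
    then have "A *\<^sub>v p1 = 0\<^sub>v n" using scalar_prod_self_pos[of "A *\<^sub>v p1" n] A p1 by force
    \<comment> \<open>\<open>Q\<close> inverts \<open>P\<close> and maps \<open>p0\<close> and
      \<open>p1\<close> to distinct unit vectors, so \<open>p1\<close> cannot be a multiple of
      \<open>p0\<close>, which \<open>ker\<close> would force.\<close>
    have Qp: "Q *\<^sub>v col P j = unit_vec n j" if "j < n" for j
    proof -
      have "col (Q * P) j = Q *\<^sub>v col P j" using that Q P by (intro eq_vecI) auto
      then show ?thesis using w that by simp
    qed
    have u01: "(unit_vec n 0 :: real vec) $ 0 = 1" "(unit_vec n 1 :: real vec) $ 1 = 1"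
       "(unit_vec n 0 :: real vec) $ 1 = 0"
      using n by auto
    have "p0 \<noteq> 0\<^sub>v n"
    proof
      assume "p0 = 0\<^sub>v n"
      then have "unit_vec n 0 = Q *\<^sub>v 0\<^sub>v n" using Qp[of 0] n by (simp add: p0_def)
      also have "\<dots> = 0\<^sub>v n" using Q by (intro eq_vecI) auto
      finally show False using u01 n by auto
    qed
    then obtain c where "p1 = c \<cdot>\<^sub>v p0"
      using ker[OF p0 p1] Ap0 \<open>A *\<^sub>v p1 = 0\<^sub>v n\<close> by blast
    then have "Q *\<^sub>v p1 = c \<cdot>\<^sub>v (Q *\<^sub>v p0)" using mult_mat_vec[OF Q p0] by simp
    then have "unit_vec n 1 = c \<cdot>\<^sub>v (unit_vec n 0 :: real vec)"
      using Qp[of 0] Qp[of 1] n by (simp add: p0_def p1_def)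
    then have "(unit_vec n 1 :: real vec) $ 1 = c * (unit_vec n 0 :: real vec) $ 1" using n by simp
    then show False using u01 by simp
  qed
qed

subsection \<open>The weighted Laplacian of a connected graph\<close>

text \<open>The Dirichlet form: the bilinear form of \<open>L(P)\<close>, on functions instead of
  vectors so that it applies directly to the transported observations.\<close>

definition dirichlet :: "nat \<Rightarrow> edge set \<Rightarrow> (nat \<Rightarrow> real) \<Rightarrow> (nat \<Rightarrow> real) \<Rightarrow> real" where
  "dirichlet n E u v =
     (\<Sum>e\<in>E. edge_prob n E e * ((u (fst e) - u (snd e)) * (v (fst e) - v (snd e))))"

lemma simple_graph_edgeE:
  assumes "simple_graph n E" "e \<in> E"
  obtains i j where "e = (i, j)" "i < n" "j < n" "i \<noteq> j"
proof -
  obtain i j where "e = (i, j)" "i < j" "j < n"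
    using assms unfolding simple_graph_def by blast
  then show ?thesis using that[of i j] by simp
qed

lemma weighted_laplacian_carrier [simp]: "weighted_laplacian n E \<in> carrier_mat n n"
  by (simp add: weighted_laplacian_def)

lemma edge_laplacian_index:
  assumes "a < n" "b < n" "i < n" "j < n"
  shows "edge_laplacian n (i, j) $$ (a, b) =
    (of_bool (a = i) - of_bool (a = j)) * (of_bool (b = i) - of_bool (b = j))"
  using assms by (simp add: edge_laplacian_def Let_def)

lemma edge_laplacian_symmetric:
  assumes "a < n" "b < n"
  shows "edge_laplacian n e $$ (a, b) = edge_laplacian n e $$ (b, a)"
  using assms by (simp add: edge_laplacian_def Let_def split: prod.splits)

lemma weighted_laplacian_symmetric:
  "transpose_mat (weighted_laplacian n E) = weighted_laplacian n E"
  by (intro eq_matI) (auto simp: weighted_laplacian_def edge_laplacian_symmetric)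

lemma edge_laplacian_bilinear:
  assumes "i < n" "j < n"
  shows "(\<Sum>a<n. \<Sum>b<n. u a * edge_laplacian n (i, j) $$ (a, b) * v b) = (u i - u j) * (v i - v j)"
proof -
  have *: "(\<Sum>a<n. (of_bool (a = i) - of_bool (a = j)) * f a) = f i - f j" for f :: "nat \<Rightarrow> real"
  proof -
    have "(\<Sum>a<n. (of_bool (a = i) - of_bool (a = j)) * f a) =
        (\<Sum>a<n. (if a = i then f a else 0) - (if a = j then f a else 0))"
      by (intro sum.cong) auto
    then show ?thesis using assms by (simp add: sum_subtractf)
  qed
  have "(\<Sum>a<n. \<Sum>b<n. u a * edge_laplacian n (i, j) $$ (a, b) * v b) =
      (\<Sum>a<n. (of_bool (a = i) - of_bool (a = j)) * (u a * (\<Sum>b<n. (of_bool (b = i) - of_bool (b = j)) * v b)))"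
    using assms by (intro sum.cong refl) (simp add: edge_laplacian_index sum_distrib_left mult_ac)
  then show ?thesis unfolding * by (simp add: left_diff_distrib)
qed

lemma weighted_laplacian_bilinear:
  assumes E: "simple_graph n E" and u: "u \<in> carrier_vec n" and v: "v \<in> carrier_vec n"
  shows "u \<bullet> (weighted_laplacian n E *\<^sub>v v) = dirichlet n E (vec_index u) (vec_index v)"
proof -
  have "u \<bullet> (weighted_laplacian n E *\<^sub>v v) =
      (\<Sum>a<n. \<Sum>b<n. \<Sum>e\<in>E. edge_prob n E e * (u $ a * edge_laplacian n e $$ (a, b) * v $ b))"
    using u v unfolding scalar_prod_def
    by (auto simp: weighted_laplacian_def scalar_prod_def lessThan_atLeast0 sum_distrib_left
        sum_distrib_right mult_ac intro!: sum.cong)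
  also have "\<dots> = (\<Sum>e\<in>E. \<Sum>a<n. \<Sum>b<n. edge_prob n E e * (u $ a * edge_laplacian n e $$ (a, b) * v $ b))"
  proof -
    have "(\<Sum>a<n. \<Sum>b<n. \<Sum>e\<in>E. f a b e) = (\<Sum>e\<in>E. \<Sum>a<n. \<Sum>b<n. f a b e)" for f :: "nat \<Rightarrow> nat \<Rightarrow> edge \<Rightarrow> real"
    proof -
      have "(\<Sum>a<n. \<Sum>b<n. \<Sum>e\<in>E. f a b e) = (\<Sum>a<n. \<Sum>e\<in>E. \<Sum>b<n. f a b e)"
        by (rule sum.cong[OF refl], rule sum.swap)
      also have "\<dots> = (\<Sum>e\<in>E. \<Sum>a<n. \<Sum>b<n. f a b e)" by (rule sum.swap)
      finally show ?thesis .
    qed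
    then show ?thesis by (simp only:)
  qed
  also have "\<dots> = dirichlet n E (vec_index u) (vec_index v)"
    unfolding dirichlet_def
  proof (intro sum.cong refl)
    fix e assume "e \<in> E"
    then obtain i j where e: "e = (i, j)" "i < n" "j < n"
      using E by (elim simple_graph_edgeE)
    show "(\<Sum>a<n. \<Sum>b<n. edge_prob n E e * (u $ a * edge_laplacian n e $$ (a, b) * v $ b)) =
       edge_prob n E e * ((u $ fst e - u $ snd e) * (v $ fst e - v $ snd e))"
      unfolding e(1) fst_conv snd_conv
        edge_laplacian_bilinear[OF e(2,3), of "vec_index u" "vec_index v", symmetric]
      by (simp only: sum_distrib_left)
  qed
  finally show ?thesis .
qed

section \<open>Semidefiniteness and kernel of the Laplacian\<close>

lemma edge_prob_pos:
  assumes "simple_graph n E" "connected_graph n E" "n \<ge> 2" "e \<in> E"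
  shows "edge_prob n E e > 0"
proof -
  obtain i j where e: "e = (i, j)" "i < n" "j < n"
    using assms(1,4) by (elim simple_graph_edgeE)
  then show ?thesis
    using degree_of_pos[OF assms(1-3), of i] degree_of_pos[OF assms(1-3), of j] assms(3)
    by (auto simp: edge_prob_def add_pos_pos)
qed

lemma dirichlet_nonneg:
  assumes "simple_graph n E" "connected_graph n E" "n \<ge> 2"
  shows "dirichlet n E u u \<ge> 0"
  unfolding dirichlet_def using edge_prob_pos[OF assms] by (intro sum_nonneg) (simp add: less_imp_le)

text \<open>Zero energy forces equality across each edge, since every edge has positive weight;
  paths spread the equality to all nodes.\<close>

lemma dirichlet_eq_0_imp_constant:
  assumes "simple_graph n E" "connected_graph n E" "n \<ge> 2"
    and 0: "dirichlet n E u u = 0" and a: "a < n" and b: "b < n"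
  shows "u a = u b"
proof -
  have "\<forall>e\<in>E. edge_prob n E e * ((u (fst e) - u (snd e)) * (u (fst e) - u (snd e))) = 0"
    using 0 edge_prob_pos[OF assms(1-3)] finite_simple_graph[OF assms(1)] unfolding dirichlet_def
    by (subst (asm) sum_nonneg_eq_0_iff) (auto simp: less_imp_le)
  then have edge: "u (fst e) = u (snd e)" if "e \<in> E" for e
    using that edge_prob_pos[OF assms(1-3) that] by auto
  have "(a, b) \<in> (adjacency E)\<^sup>*" using assms by (auto simp: connected_graph_def)
  then show ?thesis
    by induction (use edge in \<open>force simp: adjacency_def\<close>)+
qed

text \<open>The kernel of the Laplacian consists of the constant vectors, hence is
  one-dimensional.\<close>

lemma second_smallest_eigenvalue_weighted_laplacian_pos:
  assumes "simple_graph n E" "connected_graph n E" "n \<ge> 2"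
  shows "second_smallest_eigenvalue (weighted_laplacian n E) > 0"
proof (rule second_smallest_eigenvalue_pos[OF weighted_laplacian_carrier weighted_laplacian_symmetric assms(3)])
  show "0 \<le> v \<bullet> (weighted_laplacian n E *\<^sub>v v)" if "v \<in> carrier_vec n" for v
    using that assms by (simp add: weighted_laplacian_bilinear dirichlet_nonneg)
next
  fix u v :: "real vec"
  assume u: "u \<in> carrier_vec n" and v: "v \<in> carrier_vec n" and "u \<noteq> 0\<^sub>v n"
    and ker: "weighted_laplacian n E *\<^sub>v u = 0\<^sub>v n" "weighted_laplacian n E *\<^sub>v v = 0\<^sub>v n"
  have const: "w $ a = w $ 0"
    if "w \<in> carrier_vec n" "weighted_laplacian n E *\<^sub>v w = 0\<^sub>v n" "a < n" for w a
  proof (rule dirichlet_eq_0_imp_constant[OF assms])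
    show "dirichlet n E (vec_index w) (vec_index w) = 0"
      using weighted_laplacian_bilinear[OF assms(1) that(1,1)] that by simp
  qed (use that in auto)
  have u0: "u $ 0 \<noteq> 0"
  proof
    assume "u $ 0 = 0"
    then have "u = 0\<^sub>v n" using const[OF u ker(1)] u by (intro eq_vecI) auto
    with \<open>u \<noteq> 0\<^sub>v n\<close> show False ..
  qed
  have "v = (v $ 0 / u $ 0) \<cdot>\<^sub>v u"
  proof (rule eq_vecI)
    fix a assume "a < dim_vec ((v $ 0 / u $ 0) \<cdot>\<^sub>v u)"
    then have "a < n" using u by simp
    then show "v $ a = ((v $ 0 / u $ 0) \<cdot>\<^sub>v u) $ a"
      using const[OF u ker(1) \<open>a < n\<close>] const[OF v ker(2) \<open>a < n\<close>] u u0 by simp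
  qed (use u v in simp)
  then show "\<exists>c. v = c \<cdot>\<^sub>v u" ..
qed

text \<open>The Laplacian plus the all-ones matrix is invertible, and solving against it produces a
  solution of the Poisson equation because the right-hand side sums to 0.\<close>

lemma poisson_equation:
  assumes "simple_graph n E" "connected_graph n E" "n \<ge> 2" "k < n"
  obtains w :: "nat \<Rightarrow> real" where "\<And>z. dirichlet n E z w = z k - (\<Sum>l<n. z l) / real n"
proof -
  define A where "A = weighted_laplacian n E + mat n n (\<lambda>_. 1)"
  have A: "A \<in> carrier_mat n n" by (simp add: A_def)
  have ones: "u \<bullet> (mat n n (\<lambda>_. 1) *\<^sub>v v) = (\<Sum>l<n. u $ l) * (\<Sum>l<n. v $ l)"
    if "u \<in> carrier_vec n" "v \<in> carrier_vec n" for u v :: "real vec"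
    using that by (auto simp: scalar_prod_def sum_distrib_right lessThan_atLeast0 intro!: sum.cong)
  have bil: "u \<bullet> (A *\<^sub>v v) = dirichlet n E (vec_index u) (vec_index v) + (\<Sum>l<n. u $ l) * (\<Sum>l<n. v $ l)"
    if "u \<in> carrier_vec n" "v \<in> carrier_vec n" for u v :: "real vec"
  proof -
    have "A *\<^sub>v v = weighted_laplacian n E *\<^sub>v v + mat n n (\<lambda>_. 1) *\<^sub>v v"
      unfolding A_def using that by (intro add_mult_distrib_mat_vec) auto
    then have "u \<bullet> (A *\<^sub>v v) = u \<bullet> (weighted_laplacian n E *\<^sub>v v) + u \<bullet> (mat n n (\<lambda>_. 1) *\<^sub>v v)"
      using scalar_prod_add_distrib[OF that(1) mult_mat_vec_carrier[OF weighted_laplacian_carrier that(2)]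
        mult_mat_vec_carrier[OF mat_carrier that(2)]] by simp
    then show ?thesis
      using that by (simp add: weighted_laplacian_bilinear[OF assms(1)] ones)
  qed
  \<comment> \<open>If \<open>A\<close> kills \<open>v\<close>, then the energy of \<open>v\<close>
    and the square of its sum add up to 0. Both vanish, so \<open>v\<close> is constant with sum
    0.\<close>
  have "det A \<noteq> 0"
  proof
    assume "det A = 0"
    then obtain v where v: "v \<in> carrier_vec n" "v \<noteq> 0\<^sub>v n" "A *\<^sub>v v = 0\<^sub>v n"
      using det_0_iff_vec_prod_zero[OF A] by blast
    have "dirichlet n E (vec_index v) (vec_index v) + (\<Sum>l<n. v $ l)\<^sup>2 = 0"
      using bil[OF v(1,1)] v by (simp add: power2_eq_square)
    then have "dirichlet n E (vec_index v) (vec_index v) = 0" and sum: "(\<Sum>l<n. v $ l) = 0"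
      using dirichlet_nonneg[OF assms(1-3), of "vec_index v"] by (auto simp: add_nonneg_eq_0_iff)
    then have const: "v $ a = v $ 0" if "a < n" for a
      using dirichlet_eq_0_imp_constant[OF assms(1-3) _ that, of "vec_index v" 0] assms(3) by simp
    have "(\<Sum>l<n. v $ l) = (\<Sum>l<n. v $ 0)" by (rule sum.cong[OF refl], rule const) simp
    with sum assms(3) have "v $ 0 = 0" by simp
    then have "v $ a = 0" if "a < n" for a using const[OF that] by simp
    then have "v = 0\<^sub>v n" using v(1) by (intro eq_vecI) auto
    with v show False by simp
  qed
  then obtain B where B: "B \<in> carrier_mat n n" and AB: "A * B = 1\<^sub>m n"
    using det_non_zero_imp_unit[OF A, of "()"] by (auto simp: Units_def ring_mat_def)
  define y :: "real vec" where "y = vec n (\<lambda>a. of_bool (a = k) - 1 / real n)"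
  have y: "y \<in> carrier_vec n" by (simp add: y_def)
  define w where "w = B *\<^sub>v y"
  have w: "w \<in> carrier_vec n" using B y by (simp add: w_def)
  have Aw: "A *\<^sub>v w = y"
    unfolding w_def using A B y AB by (simp flip: assoc_mult_mat_vec)
  have scal: "u \<bullet> y = u $ k - (\<Sum>l<n. u $ l) / real n" if "u \<in> carrier_vec n" for u
    using that assms(4)
    by (simp add: y_def scalar_prod_def right_diff_distrib sum_subtractf sum_divide_distrib lessThan_atLeast0)
  have cong: "dirichlet n E z w' = dirichlet n E z' w'" if "\<And>l. l < n \<Longrightarrow> z l = z' l" for z z' w' :: "nat \<Rightarrow> real"
    unfolding dirichlet_def using assms(1) that
    by (intro sum.cong) (auto simp: simple_graph_def)
  have z: "dirichlet n E (vec_index (vec n z)) (vec_index w) = dirichlet n E z (vec_index w)" for z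
    by (rule cong) simp
  have key: "dirichlet n E z (vec_index w) + (\<Sum>l<n. z l) * (\<Sum>l<n. w $ l) = z k - (\<Sum>l<n. z l) / real n" for z
    using bil[OF vec_carrier w, of z] assms(4)
    by (simp add: Aw scal[OF vec_carrier] z)
  \<comment> \<open>The test function 1 has zero energy and zero right-hand side, which leaves
    \<open>n\<close> times the sum of \<open>w\<close>. Hence the all-ones term drops out of
    \<open>key\<close>.\<close>
  have "(\<Sum>l<n. w $ l) = 0"
    using key[of "\<lambda>_. 1"] assms(3) by (simp add: dirichlet_def)
  then show ?thesis using key that[of "vec_index w"] by simp
qed

subsection \<open>Independent sequences\<close>

definition iid_seq :: "'a pmf \<Rightarrow> (nat \<Rightarrow> 'a) measure" where
  "iid_seq p = PiM UNIV (\<lambda>_. measure_pmf p)"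

text \<open>A pointwise substitute for measurability with respect to the coordinates in
  \<open>I\<close>: for finite \<open>I\<close> and countable outcomes it implies measurability, and
  disjoint index sets yield independence.\<close>

definition depends_on :: "nat set \<Rightarrow> ((nat \<Rightarrow> 'a) \<Rightarrow> 'b) \<Rightarrow> bool" where
  "depends_on I F \<longleftrightarrow> (\<forall>\<omega> \<omega>'. (\<forall>i\<in>I. \<omega> i = \<omega>' i) \<longrightarrow> F \<omega> = F \<omega>')"

lemma depends_on_mono: "depends_on I F \<Longrightarrow> I \<subseteq> J \<Longrightarrow> depends_on J F"
  unfolding depends_on_def by blast

lemma depends_on_comp2:
  assumes "depends_on I F" "depends_on I G"
  shows "depends_on I (\<lambda>\<omega>. f (F \<omega>) (G \<omega>))"
  unfolding depends_on_def
proof (intro allI impI)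
  fix \<omega> \<omega>' :: "nat \<Rightarrow> 'a" assume "\<forall>i\<in>I. \<omega> i = \<omega>' i"
  then have "F \<omega> = F \<omega>'" "G \<omega> = G \<omega>'" using assms unfolding depends_on_def by blast+
  then show "f (F \<omega>) (G \<omega>) = f (F \<omega>') (G \<omega>')" by simp
qed

lemma depends_on_sum:
  fixes F :: "'b \<Rightarrow> (nat \<Rightarrow> 'a) \<Rightarrow> 'c :: comm_monoid_add"
  assumes "\<And>s. s \<in> S \<Longrightarrow> depends_on I (F s)"
  shows "depends_on I (\<lambda>\<omega>. \<Sum>s\<in>S. F s \<omega>)"
  unfolding depends_on_def
proof (intro allI impI sum.cong refl)
  fix \<omega> \<omega>' :: "nat \<Rightarrow> 'a" and s assume "\<forall>i\<in>I. \<omega> i = \<omega>' i" "s \<in> S"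
  then show "F s \<omega> = F s \<omega>'" using assms unfolding depends_on_def by blast
qed

context
  fixes p :: "'a :: countable pmf"
begin

interpretation P: product_prob_space "\<lambda>_::nat. measure_pmf p" UNIV
  by unfold_locales

interpretation S: prob_space "iid_seq p"
  unfolding iid_seq_def by (rule P.P.prob_space_axioms)

lemma prob_space_iid_seq: "prob_space (iid_seq p)"
  by unfold_locales

lemma space_iid_seq [simp]: "space (iid_seq p) = UNIV"
  by (simp add: iid_seq_def space_PiM)

text \<open>A finite product of countable discrete spaces is again discrete, so every function on it
  is measurable.\<close>

lemma depends_on_measurable_restrict:
  fixes F :: "(nat \<Rightarrow> 'a) \<Rightarrow> real"
  assumes "finite I"
  shows "F \<in> borel_measurable (PiM I (\<lambda>_. measure_pmf p))"
proof -
  have "sets (PiM I (\<lambda>_. measure_pmf p)) = sets (PiM I (\<lambda>_. count_space (UNIV :: 'a set)))"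
    by (intro sets_PiM_cong) auto
  also have "\<dots> = sets (count_space (PiE I (\<lambda>_. UNIV)))"
    using assms by (subst count_space_PiM_finite) auto
  finally have "borel_measurable (PiM I (\<lambda>_. measure_pmf p)) =
      (borel_measurable (count_space (PiE I (\<lambda>_. UNIV))) :: ((nat \<Rightarrow> 'a) \<Rightarrow> real) set)"
    by (rule measurable_cong_sets) simp
  then show ?thesis by simp
qed

lemma depends_on_factor:
  assumes "depends_on I F"
  shows "F = F \<circ> (\<lambda>\<omega>. restrict \<omega> I)"
proof
  fix \<omega> show "F \<omega> = (F \<circ> (\<lambda>\<omega>. restrict \<omega> I)) \<omega>"
    using assms unfolding depends_on_def o_def by (metis restrict_apply')
qed

lemma depends_on_measurable:
  fixes F :: "(nat \<Rightarrow> 'a) \<Rightarrow> real"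
  assumes "finite I" "depends_on I F"
  shows "F \<in> borel_measurable (iid_seq p)"
proof -
  have "(\<lambda>\<omega>. restrict \<omega> I) \<in> iid_seq p \<rightarrow>\<^sub>M PiM I (\<lambda>_. measure_pmf p)"
    unfolding iid_seq_def by (rule measurable_restrict_subset) simp
  then show ?thesis
    using measurable_comp[OF _ depends_on_measurable_restrict[OF assms(1), of F]]
      depends_on_factor[OF assms(2)] by metis
qed

lemma depends_on_integrable:
  fixes F :: "(nat \<Rightarrow> 'a) \<Rightarrow> real"
  assumes "finite I" "depends_on I F" "\<And>\<omega>. \<bar>F \<omega>\<bar> \<le> B"
  shows "integrable (iid_seq p) F"
  using assms by (intro S.integrable_const_bound[of _ B] depends_on_measurable) auto

lemma AE_iid_seq: "AE \<omega> in iid_seq p. \<forall>s. \<omega> s \<in> set_pmf p"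
  unfolding iid_seq_def AE_all_countable
  by (intro allI AE_PiM_component AE_pmfI) (auto intro: measure_pmf.prob_space_axioms)

lemma indep_vars_iid_seq: "S.indep_vars (\<lambda>_. measure_pmf p) (\<lambda>i \<omega>. \<omega> i) UNIV"
proof (subst S.indep_vars_iff_distr_eq_PiM)
  have "distr (iid_seq p) (measure_pmf p) (\<lambda>\<omega>. \<omega> i) = measure_pmf p" for i
    unfolding iid_seq_def by (intro distr_PiM_component) (auto intro: measure_pmf.prob_space_axioms)
  then show "distr (iid_seq p) (PiM UNIV (\<lambda>_. measure_pmf p)) (\<lambda>\<omega>. \<lambda>i\<in>UNIV. \<omega> i) =
      PiM UNIV (\<lambda>i. distr (iid_seq p) (measure_pmf p) (\<lambda>\<omega>. \<omega> i))"
    by (simp add: iid_seq_def restrict_UNIV distr_id2)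
  show "(\<lambda>\<omega>. \<omega> i) \<in> iid_seq p \<rightarrow>\<^sub>M measure_pmf p" for i
    unfolding iid_seq_def by (rule measurable_component_singleton) simp
qed simp

section \<open>Conditioning on one draw and sums of martingale differences\<close>

lemma integral_mult_indep:
  fixes F G :: "(nat \<Rightarrow> 'a) \<Rightarrow> real"
  assumes I: "finite I" "depends_on I F" "\<And>\<omega>. \<bar>F \<omega>\<bar> \<le> B"
    and J: "finite J" "depends_on J G" "\<And>\<omega>. \<bar>G \<omega>\<bar> \<le> C"
    and "I \<inter> J = {}"
  shows "(\<integral>\<omega>. F \<omega> * G \<omega> \<partial>iid_seq p) = (\<integral>\<omega>. F \<omega> \<partial>iid_seq p) * (\<integral>\<omega>. G \<omega> \<partial>iid_seq p)"
proof (rule S.indep_var_lebesgue_integral)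
  show "integrable (iid_seq p) F" "integrable (iid_seq p) G"
    using depends_on_integrable[OF I] depends_on_integrable[OF J] by auto
  have "S.indep_var (PiM I (\<lambda>_. measure_pmf p)) (\<lambda>\<omega>. restrict (\<lambda>i. \<omega> i) I)
      (PiM J (\<lambda>_. measure_pmf p)) (\<lambda>\<omega>. restrict (\<lambda>i. \<omega> i) J)"
    by (rule S.indep_var_restrict[OF indep_vars_iid_seq]) (use assms in auto)
  from S.indep_var_compose[OF this depends_on_measurable_restrict[OF I(1), of F]
      depends_on_measurable_restrict[OF J(1), of G]]
  show "S.indep_var borel F borel G"
    using depends_on_factor[OF I(2)] depends_on_factor[OF J(2)] by metis
qed

lemma integral_component_indicator:
  "(\<integral>\<omega>. of_bool (\<omega> s = e) \<partial>iid_seq p) = pmf p e"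
proof -
  have "(\<integral>\<omega>. of_bool (\<omega> s = e) \<partial>iid_seq p) =
      (LINT x|distr (iid_seq p) (measure_pmf p) (\<lambda>\<omega>. \<omega> s). of_bool (x = e) :: real)"
    unfolding iid_seq_def
    by (rule integral_distr[where g = "\<lambda>\<omega>. \<omega> s" and f = "\<lambda>x. of_bool (x = e)", symmetric]) auto
  also have "distr (iid_seq p) (measure_pmf p) (\<lambda>\<omega>. \<omega> s) = measure_pmf p"
    unfolding iid_seq_def by (intro distr_PiM_component) (auto intro: measure_pmf.prob_space_axioms)
  also have "(\<integral>x. of_bool (x = e) \<partial>measure_pmf p) = (\<integral>x. indicator {e} x \<partial>measure_pmf p)"
    by (intro Bochner_Integration.integral_cong refl) (auto simp: indicator_def)
  also have "\<dots> = pmf p e" by (simp add: pmf.rep_eq)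
  finally show ?thesis .
qed

text \<open>Almost surely the draw at time \<open>s\<close> lies in the finite support. Splitting by
  its value \<open>e\<close> leaves \<open>F e\<close>, a function of earlier draws and so
  independent of the event that \<open>e\<close> is drawn.\<close>

lemma integral_condition_component:
  fixes F :: "'a \<Rightarrow> (nat \<Rightarrow> 'a) \<Rightarrow> real"
  assumes fin: "finite (set_pmf p)"
    and F: "\<And>e. depends_on {..<s} (F e)" "\<And>e \<omega>. \<bar>F e \<omega>\<bar> \<le> B"
  shows "(\<integral>\<omega>. F (\<omega> s) \<omega> \<partial>iid_seq p) = (\<integral>\<omega>. (\<Sum>e\<in>set_pmf p. pmf p e * F e \<omega>) \<partial>iid_seq p)"
proof -
  have dF: "depends_on {..s} (F e)" for e
    using F(1) by (rule depends_on_mono) auto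
  have d1: "depends_on {s} (\<lambda>\<omega>. of_bool (\<omega> s = e) :: real)" for e :: 'a
    by (auto simp: depends_on_def)
  have int: "integrable (iid_seq p) (F e)" for e
    using F by (intro depends_on_integrable[of "{..<s}"]) auto
  have int1: "integrable (iid_seq p) (\<lambda>\<omega>. F e \<omega> * of_bool (\<omega> s = e))" for e
  proof (rule depends_on_integrable[of "{..s}"])
    show "depends_on {..s} (\<lambda>\<omega>. F e \<omega> * of_bool (\<omega> s = e))"
      by (rule depends_on_comp2[OF dF depends_on_mono[OF d1]]) simp
    show "\<bar>F e \<omega> * of_bool (\<omega> s = e)\<bar> \<le> B" for \<omega>
      using F(2)[of e \<omega>] by (auto simp: abs_mult)
  qed simp
  have dd: "depends_on {..s} (\<lambda>\<omega>. F (\<omega> s) \<omega>)"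
    using dF unfolding depends_on_def by (metis atMost_iff order_refl)
  have "(\<integral>\<omega>. F (\<omega> s) \<omega> \<partial>iid_seq p) = (\<integral>\<omega>. (\<Sum>e\<in>set_pmf p. F e \<omega> * of_bool (\<omega> s = e)) \<partial>iid_seq p)"
  proof (rule integral_cong_AE)
    show "AE \<omega> in iid_seq p. F (\<omega> s) \<omega> = (\<Sum>e\<in>set_pmf p. F e \<omega> * of_bool (\<omega> s = e))"
      using AE_iid_seq
    proof eventually_elim
      fix \<omega> :: "nat \<Rightarrow> 'a" assume "\<forall>s. \<omega> s \<in> set_pmf p"
      then show "F (\<omega> s) \<omega> = (\<Sum>e\<in>set_pmf p. F e \<omega> * of_bool (\<omega> s = e))"
        using fin by (subst sum.remove[of _ "\<omega> s"]) (auto intro!: sum.neutral[symmetric])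
    qed
  qed (use dd int1 in \<open>auto intro: depends_on_measurable\<close>)
  also have "\<dots> = (\<Sum>e\<in>set_pmf p. \<integral>\<omega>. F e \<omega> * of_bool (\<omega> s = e) \<partial>iid_seq p)"
    using int1 by (intro Bochner_Integration.integral_sum) auto
  also have "\<dots> = (\<Sum>e\<in>set_pmf p. (\<integral>\<omega>. F e \<omega> \<partial>iid_seq p) * pmf p e)"
  proof (rule sum.cong[OF refl])
    fix e
    show "(\<integral>\<omega>. F e \<omega> * of_bool (\<omega> s = e) \<partial>iid_seq p) = (\<integral>\<omega>. F e \<omega> \<partial>iid_seq p) * pmf p e"
      using integral_mult_indep[of "{..<s}" "F e" B "{s}" "\<lambda>\<omega>. of_bool (\<omega> s = e)" 1] F d1
      by (simp add: integral_component_indicator)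
  qed
  also have "\<dots> = (\<integral>\<omega>. (\<Sum>e\<in>set_pmf p. pmf p e * F e \<omega>) \<partial>iid_seq p)"
    using int by (simp add: mult.commute)
  finally show ?thesis .
qed

text \<open>\<open>\<psi> s e \<omega>\<close> is the increment at time \<open>s\<close> if
  \<open>e\<close> is drawn after the history in \<open>\<omega>\<close>. Its mean over
  \<open>e\<close> vanishes for every history, so increments are orthogonal and each adds at most
  the square of \<open>B\<close>.\<close>

lemma martingale_second_moment:
  fixes \<psi> :: "nat \<Rightarrow> 'a \<Rightarrow> (nat \<Rightarrow> 'a) \<Rightarrow> real"
  assumes fin: "finite (set_pmf p)"
    and dep: "\<And>s e. depends_on {..<s} (\<psi> s e)" and bnd: "\<And>s e \<omega>. \<bar>\<psi> s e \<omega>\<bar> \<le> B"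
    and mean: "\<And>s \<omega>. (\<Sum>e\<in>set_pmf p. pmf p e * \<psi> s e \<omega>) = 0"
  shows "(\<integral>\<omega>. (\<Sum>s=1..t. \<psi> s (\<omega> s) \<omega>)\<^sup>2 \<partial>iid_seq p) \<le> real t * B\<^sup>2"
proof (induction t)
  case (Suc t)
  define A where "A = (\<lambda>\<omega>. \<Sum>s=1..t. \<psi> s (\<omega> s) \<omega>)"
  define \<xi> where "\<xi> = (\<lambda>\<omega>. \<psi> (Suc t) (\<omega> (Suc t)) \<omega>)"
  have dpsi: "depends_on {..<t'} (\<lambda>\<omega>. \<psi> s (\<omega> s) \<omega>)" if "s < t'" for s t'
    using depends_on_mono[OF dep, of s "{..<t'}"] that unfolding depends_on_def
    by (metis ivl_subset lessThan_iff lessThan_subset_iff less_imp_le)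
  have dA: "depends_on {..<Suc t} A"
    unfolding A_def by (intro depends_on_sum dpsi) auto
  have dxi: "depends_on {..<Suc (Suc t)} \<xi>"
    unfolding \<xi>_def by (intro dpsi) auto
  have dA': "depends_on {..<Suc (Suc t)} A" using dA by (rule depends_on_mono) auto
  have "B \<ge> 0" using bnd[of 0 undefined undefined] by linarith
  have bA: "\<bar>A \<omega>\<bar> \<le> real t * B" for \<omega>
  proof -
    have "\<bar>A \<omega>\<bar> \<le> (\<Sum>s=1..t. \<bar>\<psi> s (\<omega> s) \<omega>\<bar>)" unfolding A_def by (rule sum_abs)
    also have "\<dots> \<le> (\<Sum>s=1..t. B)" by (intro sum_mono bnd)
    finally show ?thesis by simp
  qed
  have bxi: "\<bar>\<xi> \<omega>\<bar> \<le> B" for \<omega> by (simp add: \<xi>_def bnd)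
  have bAxi: "\<bar>A \<omega> * \<xi> \<omega>\<bar> \<le> real t * B * B" for \<omega>
    using mult_mono[OF bA[of \<omega>] bxi[of \<omega>]] \<open>B \<ge> 0\<close> by (simp add: abs_mult)
  have iA: "integrable (iid_seq p) (\<lambda>\<omega>. (A \<omega>)\<^sup>2)"
  proof (rule depends_on_integrable[of "{..<Suc t}"])
    show "depends_on {..<Suc t} (\<lambda>\<omega>. (A \<omega>)\<^sup>2)"
      by (rule depends_on_comp2[OF dA dA, of "\<lambda>a _. a\<^sup>2"])
    show "\<bar>(A \<omega>)\<^sup>2\<bar> \<le> (real t * B)\<^sup>2" for \<omega>
      using power_mono[OF bA[of \<omega>], of 2] by simp
  qed simp
  have iAxi: "integrable (iid_seq p) (\<lambda>\<omega>. A \<omega> * \<xi> \<omega>)"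
    using depends_on_comp2[OF dA' dxi, of "\<lambda>a b. a * b"] bAxi
    by (intro depends_on_integrable[of "{..<Suc (Suc t)}"]) auto
  have bxi2: "(\<xi> \<omega>)\<^sup>2 \<le> B\<^sup>2" for \<omega> using power_mono[OF bxi[of \<omega>], of 2] by simp
  have ixi: "integrable (iid_seq p) (\<lambda>\<omega>. (\<xi> \<omega>)\<^sup>2)"
    using depends_on_comp2[OF dxi dxi, of "\<lambda>a _. a\<^sup>2"] bxi2
    by (intro depends_on_integrable[of "{..<Suc (Suc t)}" _ "B\<^sup>2"]) auto
  \<comment> \<open>\<open>A\<close> involves only draws up to \<open>t\<close>, so it acts as a
    constant factor when the draw at \<open>Suc t\<close> is averaged out.\<close>
  have "(\<integral>\<omega>. A \<omega> * \<xi> \<omega> \<partial>iid_seq p) =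
      (\<integral>\<omega>. (\<Sum>e\<in>set_pmf p. pmf p e * (A \<omega> * \<psi> (Suc t) e \<omega>)) \<partial>iid_seq p)"
    unfolding \<xi>_def
  proof (rule integral_condition_component[OF fin, where F = "\<lambda>e \<omega>. A \<omega> * \<psi> (Suc t) e \<omega>"])
    show "depends_on {..<Suc t} (\<lambda>\<omega>. A \<omega> * \<psi> (Suc t) e \<omega>)" for e
      by (rule depends_on_comp2[OF dA dep])
    show "\<bar>A \<omega> * \<psi> (Suc t) e \<omega>\<bar> \<le> real t * B * B" for e \<omega>
      using mult_mono[OF bA[of \<omega>] bnd[of "Suc t" e \<omega>]] \<open>B \<ge> 0\<close> by (simp add: abs_mult)
  qed
  also have "\<dots> = (\<integral>\<omega>. A \<omega> * (\<Sum>e\<in>set_pmf p. pmf p e * \<psi> (Suc t) e \<omega>) \<partial>iid_seq p)"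
    by (simp add: sum_distrib_left mult_ac)
  also have "\<dots> = 0" by (simp add: mean)
  finally have cross: "(\<integral>\<omega>. A \<omega> * \<xi> \<omega> \<partial>iid_seq p) = 0" .
  have "(\<integral>\<omega>. (\<xi> \<omega>)\<^sup>2 \<partial>iid_seq p) \<le> (\<integral>\<omega>. B\<^sup>2 \<partial>iid_seq p)"
    using ixi bxi2 by (intro integral_mono) auto
  then have xi: "(\<integral>\<omega>. (\<xi> \<omega>)\<^sup>2 \<partial>iid_seq p) \<le> B\<^sup>2" using S.prob_space by simp
  have "(\<integral>\<omega>. (\<Sum>s=1..Suc t. \<psi> s (\<omega> s) \<omega>)\<^sup>2 \<partial>iid_seq p) =
      (\<integral>\<omega>. (A \<omega>)\<^sup>2 + 2 * (A \<omega> * \<xi> \<omega>) + (\<xi> \<omega>)\<^sup>2 \<partial>iid_seq p)"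
    by (intro Bochner_Integration.integral_cong refl) (simp add: A_def \<xi>_def power2_sum)
  also have "\<dots> = (\<integral>\<omega>. (A \<omega>)\<^sup>2 \<partial>iid_seq p) + 2 * (\<integral>\<omega>. A \<omega> * \<xi> \<omega> \<partial>iid_seq p) + (\<integral>\<omega>. (\<xi> \<omega>)\<^sup>2 \<partial>iid_seq p)"
    using iA iAxi ixi by simp
  also have "\<dots> \<le> real t * B\<^sup>2 + 2 * 0 + B\<^sup>2"
    using Suc xi cross by (simp add: A_def)
  finally show ?case by (simp add: algebra_simps)
qed simp

end

subsection \<open>Transport of the observations\<close>

lemma edge_seq_eq_iid_seq: "edge_seq n E = iid_seq (edge_pmf n E)"
  by (simp add: edge_seq_def iid_seq_def)

lemma set_edge_pmf:
  assumes "simple_graph n E" "connected_graph n E" "n \<ge> 2"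
  shows "set_pmf (edge_pmf n E) = E"
proof (rule Set.set_eqI)
  fix e show "e \<in> set_pmf (edge_pmf n E) \<longleftrightarrow> e \<in> E"
    using edge_prob_pos[OF assms, of e] by (auto simp: set_pmf_iff pmf_edge_pmf[OF assms])
qed

abbreviation swap_ends :: "edge \<Rightarrow> nat \<Rightarrow> nat" where
  "swap_ends e \<equiv> Transposition.transpose (fst e) (snd e)"

text \<open>\<open>token \<omega> m l\<close> is the node whose initial observation sits at node \<open>l\<close> after the swaps along
  \<open>\<omega> 0, \<dots>, \<omega> (m - 1)\<close>; the matrix \<open>swap_mat_prod n \<omega> m\<close> corresponds to \<open>token \<omega> (Suc m)\<close>.\<close>

primrec token :: "(nat \<Rightarrow> edge) \<Rightarrow> nat \<Rightarrow> nat \<Rightarrow> nat" where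
  "token \<omega> 0 = (\<lambda>l. l)"
| "token \<omega> (Suc m) = token \<omega> m \<circ> swap_ends (\<omega> m)"

text \<open>The bound is strict: the observation compared at time \<open>s\<close> is determined
  before the edge at \<open>s\<close> is drawn, and is therefore independent of it.\<close>

lemma depends_on_token: "depends_on {..<m} (\<lambda>\<omega>. token \<omega> m)"
proof (induction m)
  case (Suc m)
  show ?case unfolding depends_on_def
  proof (intro allI impI)
    fix \<omega> \<omega>' :: "nat \<Rightarrow> edge" assume eq: "\<forall>i\<in>{..<Suc m}. \<omega> i = \<omega>' i"
    then have "token \<omega> m = token \<omega>' m"
      using Suc unfolding depends_on_def by (metis lessThan_iff less_SucI)
    with eq show "token \<omega> (Suc m) = token \<omega>' (Suc m)" by simp
  qed
qed (simp add: depends_on_def)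

text \<open>Each step composes with a transposition of two nodes. Sums over all nodes are thus
  preserved, which keeps centred observations centred.\<close>

lemma token_permutes:
  assumes E: "simple_graph n E" and \<omega>: "\<forall>s. \<omega> s \<in> E"
  shows "token \<omega> m permutes {..<n}"
proof (induction m)
  case 0
  show ?case using permutes_id[of "{..<n}"] by (simp add: id_def)
next
  case (Suc m)
  obtain i j where "\<omega> m = (i, j)" "i < n" "j < n"
    using simple_graph_edgeE[OF E] \<omega> by metis
  then show ?case
    using permutes_compose[OF permutes_swap_id[of i "{..<n}" j] Suc] by (simp add: o_def)
qed

section \<open>Products of swap matrices as index permutations\<close>

lemma swap_mat_carrier [simp]: "swap_mat n \<omega> s \<in> carrier_mat n n"
  by (simp add: swap_mat_def edge_laplacian_def Let_def minus_carrier_mat split: prod.split)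

lemma swap_mat_prod_carrier [simp]: "swap_mat_prod n \<omega> s \<in> carrier_mat n n"
  by (induction s) (auto intro: mult_carrier_mat[of _ n n])

lemma swap_mat_mult_vec:
  assumes e: "\<omega> s = (i, j)" "i < n" "j < n" "i \<noteq> j" and x: "x \<in> carrier_vec n" and a: "a < n"
  shows "(swap_mat n \<omega> s *\<^sub>v x) $ a = x $ swap_ends (\<omega> s) a"
proof -
  have "(swap_mat n \<omega> s *\<^sub>v x) $ a = (\<Sum>b<n. swap_mat n \<omega> s $$ (a, b) * x $ b)"
    using a x carrier_matD[OF swap_mat_carrier[of n \<omega> s]] by (auto simp: scalar_prod_def lessThan_atLeast0 intro!: sum.cong)
  also have "\<dots> = (\<Sum>b<n. (if b = a then x $ b else 0)
      - (of_bool (a = i) - of_bool (a = j)) * (if b = i then x $ b else 0)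
      + (of_bool (a = i) - of_bool (a = j)) * (if b = j then x $ b else 0))"
    using a e by (intro sum.cong) (auto simp: swap_mat_def edge_laplacian_def Let_def)
  also have "\<dots> = x $ a - (of_bool (a = i) - of_bool (a = j)) * x $ i
      + (of_bool (a = i) - of_bool (a = j)) * x $ j"
    using a e by (simp add: sum.distrib sum_subtractf flip: sum_distrib_left)
  also have "\<dots> = x $ swap_ends (\<omega> s) a"
    using e by (auto simp: Transposition.transpose_def)
  finally show ?thesis .
qed

text \<open>The newest factor stands on the left, so its swap is the first to act on the index; this
  is the order of composition in \<open>token\<close>.\<close>

lemma swap_mat_prod_mult_vec:
  assumes E: "simple_graph n E" and \<omega>: "\<forall>s. \<omega> s \<in> E" and x: "x \<in> carrier_vec n" and a: "a < n"
  shows "(swap_mat_prod n \<omega> m *\<^sub>v x) $ a = x $ token \<omega> (Suc m) a"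
  using a
proof (induction m arbitrary: a)
  case 0
  obtain i j where "\<omega> 0 = (i, j)" "i < n" "j < n" "i \<noteq> j"
    using simple_graph_edgeE[OF E] \<omega> by metis
  then show ?case using swap_mat_mult_vec[OF _ _ _ _ x 0] by simp
next
  case (Suc m)
  obtain i j where e: "\<omega> (Suc m) = (i, j)" "i < n" "j < n" "i \<noteq> j"
    using simple_graph_edgeE[OF E] \<omega> by metis
  have b: "swap_ends (\<omega> (Suc m)) a < n" using Suc.prems e by (auto simp: Transposition.transpose_def)
  have y: "swap_mat_prod n \<omega> m *\<^sub>v x \<in> carrier_vec n"
    using swap_mat_prod_carrier x by (rule mult_mat_vec_carrier)
  have "swap_mat_prod n \<omega> (Suc m) *\<^sub>v x = swap_mat n \<omega> (Suc m) *\<^sub>v (swap_mat_prod n \<omega> m *\<^sub>v x)"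
    using assoc_mult_mat_vec[OF swap_mat_carrier swap_mat_prod_carrier x] by simp
  then show ?case
    using swap_mat_mult_vec[of \<omega> "Suc m", OF e y Suc.prems] Suc.IH[OF b] by simp
qed

text \<open>Moving the transpose to the other side reads off one entry of the permuted indicator
  vector. The product up to index \<open>s - 1\<close> contains the edges at times 0 to
  \<open>s - 1\<close>, so \<open>token \<omega> s\<close> gives the observation before the swap at
  time \<open>s\<close>.\<close>

lemma hvec_swap_mat_prod:
  assumes E: "simple_graph n E" and \<omega>: "\<forall>s. \<omega> s \<in> E" and k: "k < n" and s: "s \<ge> 1"
  shows "hvec n X k \<bullet> (transpose_mat (swap_mat_prod n \<omega> (s - 1)) *\<^sub>v unit_vec n k) =
    of_bool (X k > X (token \<omega> s k))"
proof -
  let ?P = "swap_mat_prod n \<omega> (s - 1)"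
  have h: "hvec n X k \<in> carrier_vec n" by (simp add: hvec_def)
  have Ph: "?P *\<^sub>v hvec n X k \<in> carrier_vec n"
    using swap_mat_prod_carrier h by (rule mult_mat_vec_carrier)
  have Pu: "transpose_mat ?P *\<^sub>v unit_vec n k \<in> carrier_vec n"
    by (rule mult_mat_vec_carrier[of _ n n]) simp_all
  have "hvec n X k \<bullet> (transpose_mat ?P *\<^sub>v unit_vec n k) = (transpose_mat ?P *\<^sub>v unit_vec n k) \<bullet> hvec n X k"
    using h Pu by (rule comm_scalar_prod)
  also have "\<dots> = unit_vec n k \<bullet> (?P *\<^sub>v hvec n X k)"
    using h by (intro transpose_vec_mult_scalar[of _ n n]) simp_all
  also have "\<dots> = (?P *\<^sub>v hvec n X k) $ k"
    using k Ph by simp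
  also have "\<dots> = hvec n X k $ token \<omega> s k"
    using swap_mat_prod_mult_vec[OF E \<omega> h k, of "s - 1"] s by simp
  also have "\<dots> = of_bool (X k > X (token \<omega> s k))"
    using permutes_in_image[OF token_permutes[OF E \<omega>], of s k] k by (simp add: hvec_def)
  finally show ?thesis .
qed

text \<open>Only the entries at \<open>i\<close> and \<open>j\<close> change, and the decrease is
  the summand of \<open>dirichlet\<close> for that edge. Averaged over the drawn edge, the expected
  decrease is the Dirichlet form of \<open>z\<close> and \<open>w\<close>.\<close>

lemma sum_swap_ends:
  fixes w z :: "nat \<Rightarrow> real"
  assumes "i < n" "j < n" "i \<noteq> j"
  shows "(\<Sum>l<n. w l * z l) - (\<Sum>l<n. w l * z (swap_ends (i, j) l)) = (z i - z j) * (w i - w j)"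
proof -
  have "(\<Sum>l<n. w l * z l) - (\<Sum>l<n. w l * z (swap_ends (i, j) l)) =
      (\<Sum>l<n. (if l = i then w l * (z i - z j) else 0) + (if l = j then w l * (z j - z i) else 0))"
    unfolding sum_subtractf[symmetric] using assms
    by (intro sum.cong) (auto simp: Transposition.transpose_def algebra_simps)
  also have "\<dots> = w i * (z i - z j) + w j * (z j - z i)"
    using assms by (simp add: sum.distrib)
  finally show ?thesis by (simp add: algebra_simps)
qed

section \<open>Second moments along the random edge sequence\<close>

definition active_prob :: "nat \<Rightarrow> edge set \<Rightarrow> nat \<Rightarrow> real" where
  "active_prob n E k = (\<Sum>e\<in>E. edge_prob n E e * of_bool (endpoint k e))"

context
  fixes n :: nat and E :: "edge set"
  assumes graph: "simple_graph n E" "connected_graph n E" "n \<ge> 2"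
begin

lemma edge_prob_le_1:
  assumes "e \<in> E" shows "edge_prob n E e \<le> 1"
  using member_le_sum[of e E "edge_prob n E"] assms finite_simple_graph[OF graph(1)] edge_prob_pos[OF graph]
  by (auto simp: sum_edge_prob[OF graph] less_imp_le)

lemma active_prob_pos:
  assumes k: "k < n"
  shows "active_prob n E k > 0"
proof -
  obtain e where e: "e \<in> E" "endpoint k e"
    using degree_of_pos[OF graph k] by (auto simp: degree_of_def card_gt_0_iff)
  then show ?thesis
    unfolding active_prob_def using edge_prob_pos[OF graph] finite_simple_graph[OF graph(1)]
    by (intro sum_pos2[of E e]) (auto simp: less_imp_le)
qed

lemma active_prob_le_1: "active_prob n E k \<le> 1"
proof -
  have "active_prob n E k \<le> (\<Sum>e\<in>E. edge_prob n E e)"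
    unfolding active_prob_def using edge_prob_pos[OF graph]
    by (intro sum_mono) (auto simp: less_imp_le)
  then show ?thesis by (simp add: sum_edge_prob[OF graph])
qed

lemma AE_edge_seq: "AE \<omega> in edge_seq n E. \<forall>s. \<omega> s \<in> E"
  using AE_iid_seq[of "edge_pmf n E"] unfolding edge_seq_eq_iid_seq set_edge_pmf[OF graph] .

lemma edge_martingale_second_moment:
  assumes "\<And>s e. depends_on {..<s} (\<psi> s e)" "\<And>s e \<omega>. \<bar>\<psi> s e \<omega>\<bar> \<le> B"
    and "\<And>s \<omega>. (\<Sum>e\<in>E. edge_prob n E e * \<psi> s e \<omega>) = 0"
  shows "(\<integral>\<omega>. (\<Sum>s=1..t. \<psi> s (\<omega> s) \<omega>)\<^sup>2 \<partial>edge_seq n E) \<le> real t * B\<^sup>2"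
  unfolding edge_seq_eq_iid_seq
proof (rule martingale_second_moment[where \<psi> = \<psi>])
  show "(\<Sum>e\<in>set_pmf (edge_pmf n E). pmf (edge_pmf n E) e * \<psi> s e \<omega>) = 0" for s \<omega>
    using assms(3)[of s \<omega>] by (simp add: set_edge_pmf[OF graph] pmf_edge_pmf[OF graph])
qed (use assms finite_simple_graph[OF graph(1)] in \<open>auto simp: set_edge_pmf[OF graph]\<close>)

text \<open>The centred activations have mean 0 and absolute value at most 1, so the martingale
  bound applies with \<open>B = 1\<close>.\<close>

lemma active_count_variance:
  assumes k: "k < n"
  shows "(\<integral>\<omega>. (active_count \<omega> k t - active_prob n E k * real t)\<^sup>2 \<partial>edge_seq n E) \<le> real t"
proof -
  define \<psi> :: "nat \<Rightarrow> edge \<Rightarrow> (nat \<Rightarrow> edge) \<Rightarrow> real"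
    where "\<psi> = (\<lambda>s e \<omega>. of_bool (endpoint k e) - active_prob n E k)"
  have "(\<integral>\<omega>. (\<Sum>s=1..t. \<psi> s (\<omega> s) \<omega>)\<^sup>2 \<partial>edge_seq n E) \<le> real t * 1\<^sup>2"
  proof (rule edge_martingale_second_moment[where \<psi> = \<psi>])
    show "\<bar>\<psi> s e \<omega>\<bar> \<le> 1" for s e \<omega>
      using active_prob_pos[OF k] active_prob_le_1 by (auto simp: \<psi>_def)
    show "(\<Sum>e\<in>E. edge_prob n E e * \<psi> s e \<omega>) = 0" for s \<omega>
      by (simp add: \<psi>_def right_diff_distrib sum_subtractf active_prob_def sum_edge_prob[OF graph]
          flip: sum_distrib_right)
  qed (simp add: depends_on_def \<psi>_def)
  moreover have "(\<Sum>s=1..t. \<psi> s (\<omega> s) \<omega>) = active_count \<omega> k t - active_prob n E k * real t" for \<omega>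
    by (simp add: \<psi>_def active_count_def active_def sum_subtractf mult.commute)
  ultimately show ?thesis by simp
qed

text \<open>The constant is chosen before \<open>g\<close>, because the Poisson solution
  \<open>w\<close> depends only on the graph and \<open>k\<close>; this is what makes the final
  bound uniform in the observations.\<close>

lemma centred_sum_second_moment:
  assumes k: "k < n"
  obtains D where "D \<ge> 0"
    "\<And>g t. \<lbrakk>\<And>l. \<bar>g l\<bar> \<le> 1; (\<Sum>l<n. g l) = 0; t \<ge> 1\<rbrakk> \<Longrightarrow>
      integrable (edge_seq n E) (\<lambda>\<omega>. (\<Sum>s=1..t. active \<omega> k s * g (token \<omega> s k))\<^sup>2) \<and>
      (\<integral>\<omega>. (\<Sum>s=1..t. active \<omega> k s * g (token \<omega> s k))\<^sup>2 \<partial>edge_seq n E) \<le> D * real t"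
proof -
  obtain w where w: "dirichlet n E z w = z k - (\<Sum>l<n. z l) / real n" for z
    using poisson_equation[OF graph k] by blast
  define p where "p = active_prob n E k"
  have p: "0 < p" "p \<le> 1" using active_prob_pos[OF k] active_prob_le_1 by (auto simp: p_def)
  define W where "W = (\<Sum>l<n. \<bar>w l\<bar>)"
  define M where "M = (\<Sum>e\<in>E. 2 * \<bar>w (fst e) - w (snd e)\<bar>)"
  have W0: "W \<ge> 0" and M0: "M \<ge> 0" by (auto simp: W_def M_def intro!: sum_nonneg)
  \<comment> \<open>The activation part of an increment is at most 1; the Dirichlet form and the
    single edge term are each at most \<open>M\<close>, and \<open>p \<le> 1\<close>.\<close>
  define B where "B = 1 + 2 * M"
  \<comment> \<open>From the square of \<open>A + b\<close> being at most twice the sum of squares,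
    with \<open>\<bar>b\<bar> \<le> 2 * W\<close> for the telescoping remainder;
    \<open>t \<ge> 1\<close> absorbs the constant term.\<close>
  define D where "D = 2 * B\<^sup>2 + 8 * W\<^sup>2"
  have "D \<ge> 0" by (simp add: D_def)
  moreover have "integrable (edge_seq n E) (\<lambda>\<omega>. (\<Sum>s=1..t. active \<omega> k s * g (token \<omega> s k))\<^sup>2) \<and>
      (\<integral>\<omega>. (\<Sum>s=1..t. active \<omega> k s * g (token \<omega> s k))\<^sup>2 \<partial>edge_seq n E) \<le> D * real t"
    if g1: "\<And>l. \<bar>g l\<bar> \<le> 1" and g0: "(\<Sum>l<n. g l) = 0" and t: "t \<ge> 1" for g :: "nat \<Rightarrow> real" and t
  proof -
    define Z where "Z = (\<lambda>s \<omega> l. g (token \<omega> s l))"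
    define a where "a = (\<lambda>e z. (z (fst e) - z (snd e)) * (w (fst e) - w (snd e)))"
    define V where "V = (\<lambda>z. \<Sum>l<n. w l * z l)"
    \<comment> \<open>The first part is the fluctuation of the activation, the second that of the
      decrease of \<open>V\<close>. Writing \<open>dirichlet\<close> in place of
      \<open>Z s \<omega> k\<close> gives mean 0 on every \<open>\<omega>\<close>, also where draws
      leave \<open>E\<close>; the value 0 off \<open>E\<close> keeps the bound \<open>B\<close>
      valid for all \<open>e\<close>.\<close>
    define \<psi> where "\<psi> = (\<lambda>s e \<omega>. if e \<in> E then (of_bool (endpoint k e) - p) * Z s \<omega> k
        + p * (dirichlet n E (Z s \<omega>) w - a e (Z s \<omega>)) else 0)"
    define S where "S = (\<lambda>\<omega>. \<Sum>s=1..t. active \<omega> k s * g (token \<omega> s k))"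
    define A where "A = (\<lambda>\<omega>. \<Sum>s=1..t. \<psi> s (\<omega> s) \<omega>)"
    have Z1: "\<bar>Z s \<omega> l\<bar> \<le> 1" for s \<omega> l by (simp add: Z_def g1)
    have a: "\<bar>a e (Z s \<omega>)\<bar> \<le> 2 * \<bar>w (fst e) - w (snd e)\<bar>" for e s \<omega>
      unfolding a_def abs_mult
      using Z1[of s \<omega> "fst e"] Z1[of s \<omega> "snd e"] by (intro mult_right_mono) auto
    have aM: "\<bar>a e (Z s \<omega>)\<bar> \<le> M" if "e \<in> E" for e s \<omega>
      using a[of e s \<omega>] member_le_sum[of e E "\<lambda>e. 2 * \<bar>w (fst e) - w (snd e)\<bar>"] that finite_simple_graph[OF graph(1)]
      by (simp add: M_def)
    have dir: "dirichlet n E z w = (\<Sum>e\<in>E. edge_prob n E e * a e z)" for z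
      by (simp add: dirichlet_def a_def)
    have dM: "\<bar>dirichlet n E (Z s \<omega>) w\<bar> \<le> M" for s \<omega>
    proof -
      have "\<bar>dirichlet n E (Z s \<omega>) w\<bar> \<le> (\<Sum>e\<in>E. \<bar>edge_prob n E e * a e (Z s \<omega>)\<bar>)"
        unfolding dir by (rule sum_abs)
      also have "\<dots> \<le> (\<Sum>e\<in>E. 1 * (2 * \<bar>w (fst e) - w (snd e)\<bar>))"
        unfolding abs_mult using edge_prob_pos[OF graph] edge_prob_le_1 a
        by (intro sum_mono mult_mono) (auto simp: less_imp_le)
      finally show ?thesis by (simp add: M_def)
    qed
    have \<psi>B: "\<bar>\<psi> s e \<omega>\<bar> \<le> B" for s e \<omega>
    proof (cases "e \<in> E")
      case True
      have "\<bar>(of_bool (endpoint k e) - p) * Z s \<omega> k\<bar> \<le> 1 * 1"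
        unfolding abs_mult using p Z1 by (intro mult_mono) auto
      moreover have "\<bar>p * (dirichlet n E (Z s \<omega>) w - a e (Z s \<omega>))\<bar> \<le> 1 * (2 * M)"
        unfolding abs_mult using p dM[of s \<omega>] aM[OF True, of s \<omega>] M0 by (intro mult_mono) auto
      ultimately show ?thesis using True by (simp add: \<psi>_def B_def)
    qed (use M0 in \<open>simp add: \<psi>_def B_def\<close>)
    have depZ: "depends_on {..<s} (Z s)" for s
      using depends_on_token[of s] unfolding Z_def depends_on_def by metis
    have dep\<psi>: "depends_on {..<s} (\<psi> s e)" for s e
      using depends_on_comp2[OF depZ[of s] depZ[of s], where f = "\<lambda>z _. if e \<in> E then (of_bool (endpoint k e) - p) * z k
        + p * (dirichlet n E z w - a e z) else 0"] by (simp add: \<psi>_def)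
    have mean: "(\<Sum>e\<in>E. edge_prob n E e * \<psi> s e \<omega>) = 0" for s \<omega>
    proof -
      have "(\<Sum>e\<in>E. edge_prob n E e * \<psi> s e \<omega>) =
          (\<Sum>e\<in>E. (edge_prob n E e * of_bool (endpoint k e)) * Z s \<omega> k - edge_prob n E e * (p * Z s \<omega> k)
            + (edge_prob n E e * (p * dirichlet n E (Z s \<omega>) w) - p * (edge_prob n E e * a e (Z s \<omega>))))"
        by (intro sum.cong) (auto simp: \<psi>_def algebra_simps)
      also have "\<dots> = active_prob n E k * Z s \<omega> k - (\<Sum>e\<in>E. edge_prob n E e) * (p * Z s \<omega> k)
          + ((\<Sum>e\<in>E. edge_prob n E e) * (p * dirichlet n E (Z s \<omega>) w) - p * dirichlet n E (Z s \<omega>) w)"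
        unfolding active_prob_def sum.distrib sum_subtractf sum_distrib_right
        by (simp only: dir sum_distrib_left)
      also have "\<dots> = 0" by (simp add: sum_edge_prob[OF graph] p_def)
      finally show ?thesis .
    qed
    have depA: "depends_on {..t} A"
      unfolding A_def
    proof (rule depends_on_sum)
      fix s assume "s \<in> {1..t}"
      then show "depends_on {..t} (\<lambda>\<omega>. \<psi> s (\<omega> s) \<omega>)"
        using depends_on_mono[OF dep\<psi>, of s "{..t}"] unfolding depends_on_def
        by (metis atLeastAtMost_iff atMost_iff lessThan_subset_iff lessThan_iff less_imp_le order_trans subsetI)
    qed
    have BA: "\<bar>A \<omega>\<bar> \<le> real t * B" for \<omega>
    proof -
      have "\<bar>A \<omega>\<bar> \<le> (\<Sum>s=1..t. \<bar>\<psi> s (\<omega> s) \<omega>\<bar>)" unfolding A_def by (rule sum_abs)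
      also have "\<dots> \<le> (\<Sum>s=1..t. B)" by (intro sum_mono \<psi>B)
      finally show ?thesis by simp
    qed
    have intA: "integrable (edge_seq n E) (\<lambda>\<omega>. (A \<omega>)\<^sup>2)"
      unfolding edge_seq_eq_iid_seq
    proof (rule depends_on_integrable[of "{..t}"])
      show "depends_on {..t} (\<lambda>\<omega>. (A \<omega>)\<^sup>2)"
        by (rule depends_on_comp2[OF depA depA, of "\<lambda>a _. a\<^sup>2"])
      show "\<bar>(A \<omega>)\<^sup>2\<bar> \<le> (real t * B)\<^sup>2" for \<omega>
        using power_mono[OF BA[of \<omega>], of 2] by simp
    qed simp
    have depS: "depends_on {..t} S"
      unfolding S_def
    proof (rule depends_on_sum)
      fix s assume s: "s \<in> {1..t}"
      have "depends_on {..t} (\<lambda>\<omega>. token \<omega> s)"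
        using depends_on_token by (rule depends_on_mono) (use s in auto)
      moreover have "depends_on {..t} (\<lambda>\<omega>. active \<omega> k s)"
        using s by (simp add: depends_on_def active_def)
      ultimately show "depends_on {..t} (\<lambda>\<omega>. active \<omega> k s * g (token \<omega> s k))"
        by (rule depends_on_comp2[where f = "\<lambda>\<tau> x. x * g (\<tau> k)"])
    qed
    have BS: "\<bar>S \<omega>\<bar> \<le> real t" for \<omega>
    proof -
      have "\<bar>S \<omega>\<bar> \<le> (\<Sum>s=1..t. \<bar>active \<omega> k s * g (token \<omega> s k)\<bar>)" unfolding S_def by (rule sum_abs)
      also have "\<dots> \<le> (\<Sum>s=1..t. 1)"
        by (intro sum_mono) (auto simp: active_def abs_mult g1)
      finally show ?thesis by simp
    qed
    have intS: "integrable (edge_seq n E) (\<lambda>\<omega>. (S \<omega>)\<^sup>2)"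
      unfolding edge_seq_eq_iid_seq
    proof (rule depends_on_integrable[of "{..t}"])
      show "depends_on {..t} (\<lambda>\<omega>. (S \<omega>)\<^sup>2)"
        by (rule depends_on_comp2[OF depS depS, of "\<lambda>a _. a\<^sup>2"])
      show "\<bar>(S \<omega>)\<^sup>2\<bar> \<le> (real t)\<^sup>2" for \<omega>
        using power_mono[OF BS[of \<omega>], of 2] by simp
    qed simp
    \<comment> \<open>The sum starts at time 1, after the edge at time 0 has already swapped, so the
      telescoping starts from \<open>Z 1\<close>.\<close>
    have decomp: "(\<Sum>s=1..m. active \<omega> k s * g (token \<omega> s k)) =
        (\<Sum>s=1..m. \<psi> s (\<omega> s) \<omega>) + p * (V (Z 1 \<omega>) - V (Z (Suc m) \<omega>))"
      if \<omega>: "\<forall>s. \<omega> s \<in> E" for \<omega> m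
    proof (induction m)
      case (Suc m)
      obtain i j where e: "\<omega> (Suc m) = (i, j)" "i < n" "j < n" "i \<noteq> j"
        using simple_graph_edgeE[OF graph(1)] \<omega> by metis
      \<comment> \<open>The transported values still sum to 0, so the Poisson equation reduces to
        the value at \<open>k\<close>, and \<open>\<psi>\<close> becomes the wanted summand minus
        \<open>p\<close> times the decrease of \<open>V\<close>.\<close>
      have "(\<Sum>l<n. Z (Suc m) \<omega> l) = (\<Sum>l<n. g l)"
        using sum.permute[OF token_permutes[OF graph(1) \<omega>], of g "Suc m"] by (simp only: Z_def o_def)
      then have "dirichlet n E (Z (Suc m) \<omega>) w = Z (Suc m) \<omega> k" by (simp add: w g0)
      then have "\<psi> (Suc m) (\<omega> (Suc m)) \<omega> =
          active \<omega> k (Suc m) * g (token \<omega> (Suc m) k) - p * a (\<omega> (Suc m)) (Z (Suc m) \<omega>)"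
        using \<omega> by (simp add: \<psi>_def active_def Z_def algebra_simps del: token.simps)
      moreover have "V (Z (Suc m) \<omega>) - V (Z (Suc (Suc m)) \<omega>) = a (\<omega> (Suc m)) (Z (Suc m) \<omega>)"
        using sum_swap_ends[OF e(2-4), of w "Z (Suc m) \<omega>"] unfolding V_def a_def e(1) fst_conv snd_conv
        by (simp add: Z_def e(1))
      ultimately show ?case using Suc by (simp add: algebra_simps del: token.simps)
    qed simp
    have V: "\<bar>V (Z s \<omega>)\<bar> \<le> W" for s \<omega>
    proof -
      have "\<bar>V (Z s \<omega>)\<bar> \<le> (\<Sum>l<n. \<bar>w l\<bar> * \<bar>Z s \<omega> l\<bar>)" unfolding V_def abs_mult[symmetric] by (rule sum_abs)
      also have "\<dots> \<le> (\<Sum>l<n. \<bar>w l\<bar> * 1)" using Z1 by (intro sum_mono mult_left_mono) auto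
      finally show ?thesis by (simp add: W_def)
    qed
    have S2: "(S \<omega>)\<^sup>2 \<le> 2 * (A \<omega>)\<^sup>2 + 8 * W\<^sup>2" if "\<forall>s. \<omega> s \<in> E" for \<omega>
    proof -
      define b where "b = p * (V (Z 1 \<omega>) - V (Z (Suc t) \<omega>))"
      have "S \<omega> = A \<omega> + b" unfolding S_def A_def b_def using decomp[OF that] .
      have "\<bar>b\<bar> \<le> 1 * (2 * W)"
        unfolding b_def abs_mult using p V[of 1 \<omega>] V[of "Suc t" \<omega>] W0 by (intro mult_mono) auto
      then have "b\<^sup>2 \<le> (2 * W)\<^sup>2" using power_mono[of "\<bar>b\<bar>" "2 * W" 2] by simp
      moreover have "(A \<omega> + b)\<^sup>2 \<le> 2 * (A \<omega>)\<^sup>2 + 2 * b\<^sup>2"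
        using zero_le_power2[of "A \<omega> - b"] by (simp add: power2_sum power2_diff)
      ultimately show ?thesis unfolding \<open>S \<omega> = A \<omega> + b\<close> by (simp add: power_mult_distrib)
    qed
    have "prob_space (edge_seq n E)" unfolding edge_seq_eq_iid_seq by (rule prob_space_iid_seq)
    then interpret prob_space "edge_seq n E" .
    have "(\<integral>\<omega>. (S \<omega>)\<^sup>2 \<partial>edge_seq n E) \<le> (\<integral>\<omega>. 2 * (A \<omega>)\<^sup>2 + 8 * W\<^sup>2 \<partial>edge_seq n E)"
    proof (rule integral_mono_AE)
      show "AE \<omega> in edge_seq n E. (S \<omega>)\<^sup>2 \<le> 2 * (A \<omega>)\<^sup>2 + 8 * W\<^sup>2"
        using AE_edge_seq by eventually_elim (rule S2)
    qed (use intS intA in auto)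
    also have "\<dots> = 2 * (\<integral>\<omega>. (A \<omega>)\<^sup>2 \<partial>edge_seq n E) + 8 * W\<^sup>2"
      using intA prob_space by simp
    also have "\<dots> \<le> 2 * (real t * B\<^sup>2) + 8 * W\<^sup>2"
      using edge_martingale_second_moment[where \<psi> = \<psi>, OF dep\<psi> \<psi>B mean] by (simp add: A_def)
    also have "\<dots> \<le> 2 * (real t * B\<^sup>2) + real t * (8 * W\<^sup>2)"
      using t mult_right_mono[of 1 "real t" "8 * W\<^sup>2"] by simp
    also have "\<dots> = D * real t" by (simp add: D_def algebra_simps)
    finally show ?thesis using intS by (simp add: S_def)
  qed
  ultimately show ?thesis using that by blast
qed

end

subsection \<open>The error of the estimate\<close>

text \<open>Expand the square of \<open>\<bar>x\<bar> - a\<close>. The bound replaces a first moment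
  by a second moment, with \<open>a\<close> of the order of the standard deviation.\<close>

lemma two_abs_le_square_div:
  fixes x a :: real
  assumes "a > 0"
  shows "2 * \<bar>x\<bar> \<le> x\<^sup>2 / a + a"
proof -
  have "2 * (\<bar>x\<bar> * a) \<le> x\<^sup>2 + a\<^sup>2"
    using zero_le_power2[of "\<bar>x\<bar> - a"] by (simp add: power2_diff)
  then show ?thesis using assms by (simp add: field_simps power2_eq_square)
qed

lemma rank_of_bounds: "rank_of n X k \<ge> 1" "rank_of n X k \<le> 1 + real n"
proof -
  have "(\<Sum>l<n. of_bool (X k > X l)) \<le> (\<Sum>l<n. 1 :: real)" by (intro sum_mono) simp
  then show "rank_of n X k \<le> 1 + real n" by (simp add: rank_of_def)
  show "rank_of n X k \<ge> 1" by (simp add: rank_of_def sum_nonneg)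
qed

text \<open>The comparison of \<open>k\<close> with itself contributes 0, leaving at most
  \<open>n - 1\<close> indicators.\<close>

lemma rank_of_le:
  assumes "k < n" shows "rank_of n X k \<le> real n"
proof -
  have "(\<Sum>l<n. of_bool (X k > X l)) = (\<Sum>l\<in>{..<n} - {k}. of_bool (X k > X l) :: real)"
    using assms by (subst sum.remove[of _ k]) auto
  also have "\<dots> \<le> (\<Sum>l\<in>{..<n} - {k}. 1)" by (intro sum_mono) simp
  also have "\<dots> = real n - 1" using assms by (simp add: of_nat_diff)
  finally show ?thesis by (simp add: rank_of_def)
qed

lemma active_count_nonneg: "active_count \<omega> k t \<ge> 0"
  by (simp add: active_count_def active_def sum_nonneg)

text \<open>Division by 0 gives 0, so the formula also returns the initial value 1 when
  \<open>k\<close> has not been activated, and the case split disappears.\<close>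

lemma gorank_eq:
  assumes "simple_graph n E" "\<forall>s. \<omega> s \<in> E" "k < n"
  shows "gorank n X \<omega> k t =
    1 + real n * ((\<Sum>s=1..t. active \<omega> k s * of_bool (X k > X (token \<omega> s k))) / active_count \<omega> k t)"
proof -
  have "(\<Sum>s=1..t. active \<omega> k s *
           (hvec n X k \<bullet> (transpose_mat (swap_mat_prod n \<omega> (s - 1)) *\<^sub>v unit_vec n k))) =
      (\<Sum>s=1..t. active \<omega> k s * of_bool (X k > X (token \<omega> s k)))"
    using hvec_swap_mat_prod[OF assms] by (intro sum.cong) auto
  then show ?thesis by (simp add: gorank_def)
qed

lemma gorank_bounds:
  assumes "simple_graph n E" "\<forall>s. \<omega> s \<in> E" "k < n"
  shows "1 \<le> gorank n X \<omega> k t" "gorank n X \<omega> k t \<le> 1 + real n"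
proof -
  let ?S = "\<Sum>s=1..t. active \<omega> k s * of_bool (X k > X (token \<omega> s k))"
  have "?S \<le> active_count \<omega> k t"
    unfolding active_count_def by (intro sum_mono) (auto simp: active_def)
  then have le: "?S / active_count \<omega> k t \<le> 1"
    using active_count_nonneg[of \<omega> k t] by (cases "active_count \<omega> k t = 0") (auto simp: divide_le_eq)
  then show "gorank n X \<omega> k t \<le> 1 + real n"
    unfolding gorank_eq[OF assms] using mult_left_mono[OF le, of "real n"] by simp
  have "?S \<ge> 0" by (simp add: active_def sum_nonneg)
  then show "1 \<le> gorank n X \<omega> k t"
    unfolding gorank_eq[OF assms] using active_count_nonneg[of \<omega> k t] by simp
qed

text \<open>On \<open>C \<ge> p t / 2\<close> the first summand bounds the error, as \<open>2 \<bar>S\<bar> \<le> S\<^sup>2 / \<surd>t + \<surd>t\<close>; on the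
  complement the second summand is at least \<open>n\<close>.\<close>

lemma gorank_error_le:
  fixes X :: "nat \<Rightarrow> real"
  assumes g: "simple_graph n E" "\<forall>s. \<omega> s \<in> E" "k < n" and n: "n \<ge> 2" and p: "p > 0" and t: "t \<ge> 1"
  defines "S \<equiv> \<Sum>s=1..t. active \<omega> k s * (of_bool (X k > X (token \<omega> s k)) - (rank_of n X k - 1) / real n)"
    and "C \<equiv> active_count \<omega> k t"
  shows "\<bar>gorank n X \<omega> k t - rank_of n X k\<bar> \<le>
    real n * ((S\<^sup>2 / sqrt (real t) + sqrt (real t)) / (p * real t) + 4 * (C - p * real t)\<^sup>2 / (p * real t)\<^sup>2)"
proof -
  let ?H = "\<Sum>s=1..t. active \<omega> k s * of_bool (X k > X (token \<omega> s k))"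
  have pt: "p * real t > 0" using p t by simp
  have st: "sqrt (real t) > 0" using t by simp
  have SH: "S = ?H - C * ((rank_of n X k - 1) / real n)"
    unfolding S_def C_def active_count_def by (simp only: right_diff_distrib sum_subtractf sum_distrib_right)
  show ?thesis
  proof (cases "C \<ge> p * real t / 2")
    case True
    then have C: "C > 0" using pt by linarith
    have "gorank n X \<omega> k t - rank_of n X k = real n * (S / C)"
      unfolding gorank_eq[OF g] SH C_def[symmetric] using C n by (simp add: field_simps)
    then have "\<bar>gorank n X \<omega> k t - rank_of n X k\<bar> = real n * (\<bar>S\<bar> / C)"
      using C by (simp add: abs_mult)
    also have "\<dots> \<le> real n * (\<bar>S\<bar> / (p * real t / 2))"
      using True pt C by (intro mult_left_mono divide_left_mono) auto
    also have "\<dots> = real n * (2 * \<bar>S\<bar> / (p * real t))" by simp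
    also have "\<dots> \<le> real n * ((S\<^sup>2 / sqrt (real t) + sqrt (real t)) / (p * real t))"
      using two_abs_le_square_div[OF st, of S] pt by (intro mult_left_mono divide_right_mono) auto
    also have "\<dots> \<le> real n * ((S\<^sup>2 / sqrt (real t) + sqrt (real t)) / (p * real t) + 4 * (C - p * real t)\<^sup>2 / (p * real t)\<^sup>2)"
      by (intro mult_left_mono) auto
    finally show ?thesis .
  next
    case False
    then have "p * real t / 2 \<le> p * real t - C" by linarith
    then have "(p * real t / 2)\<^sup>2 \<le> (p * real t - C)\<^sup>2" using pt by (intro power_mono) auto
    then have "(p * real t)\<^sup>2 \<le> 4 * (C - p * real t)\<^sup>2" by (simp add: power_divide power2_commute)
    then have 1: "1 \<le> 4 * (C - p * real t)\<^sup>2 / (p * real t)\<^sup>2" using p t by (simp add: le_divide_eq)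
    have "\<bar>gorank n X \<omega> k t - rank_of n X k\<bar> \<le> real n * 1"
      using gorank_bounds[OF g, of X t] rank_of_bounds[where X = X and n = n and k = k] by simp
    also have "\<dots> \<le> real n * ((S\<^sup>2 / sqrt (real t) + sqrt (real t)) / (p * real t) + 4 * (C - p * real t)\<^sup>2 / (p * real t)\<^sup>2)"
    proof (rule mult_left_mono)
      have "(S\<^sup>2 / sqrt (real t) + sqrt (real t)) / (p * real t) \<ge> 0" using pt st by simp
      with 1 show "1 \<le> (S\<^sup>2 / sqrt (real t) + sqrt (real t)) / (p * real t) + 4 * (C - p * real t)\<^sup>2 / (p * real t)\<^sup>2"
        by linarith
    qed simp
    finally show ?thesis .
  qed
qed

text \<open>Integrate the pointwise error bound: the second moment of the centred sum and the
  variance of the activation count are both of order \<open>t\<close>.\<close>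

lemma gorank_expected_error:
  assumes graph: "simple_graph n E" "connected_graph n E" "n \<ge> 2" and k: "k < n"
  obtains D where "D \<ge> 0" "\<And>X t. t \<ge> 1 \<Longrightarrow>
    (\<integral>\<omega>. \<bar>gorank n X \<omega> k t - rank_of n X k\<bar> \<partial>edge_seq n E) \<le> D / sqrt (real t)"
proof -
  obtain D0 where D0: "D0 \<ge> 0" and second: "\<And>g t. \<lbrakk>\<And>l. \<bar>g l\<bar> \<le> 1; (\<Sum>l<n. g l) = 0; t \<ge> 1\<rbrakk> \<Longrightarrow>
      integrable (edge_seq n E) (\<lambda>\<omega>. (\<Sum>s=1..t. active \<omega> k s * g (token \<omega> s k))\<^sup>2) \<and>
      (\<integral>\<omega>. (\<Sum>s=1..t. active \<omega> k s * g (token \<omega> s k))\<^sup>2 \<partial>edge_seq n E) \<le> D0 * real t"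
    using centred_sum_second_moment[OF graph k] by blast
  define p where "p = active_prob n E k"
  have p: "0 < p" using active_prob_pos[OF graph k] by (simp add: p_def)
  \<comment> \<open>With \<open>u\<close> the square root of \<open>t\<close>, the two parts
    contribute \<open>(D0 + 1) / (p * u)\<close> and \<open>4 / (p * u)\<^sup>2\<close>; since
    \<open>u \<ge> 1\<close>, the latter is at most \<open>4 / (p\<^sup>2 * u)\<close>.\<close>
  define D where "D = real n * ((D0 + 1) / p + 4 / p\<^sup>2)"
  have "D \<ge> 0" using D0 p by (simp add: D_def)
  moreover have "(\<integral>\<omega>. \<bar>gorank n X \<omega> k t - rank_of n X k\<bar> \<partial>edge_seq n E) \<le> D / sqrt (real t)"
    if t: "t \<ge> 1" for X t
  proof -
    \<comment> \<open>Subtracting the true average of the indicators makes \<open>g\<close> sum to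
      0; its values stay within 1 for every \<open>X\<close>, so one \<open>D0\<close> serves all
      observations.\<close>
    define g :: "nat \<Rightarrow> real" where "g = (\<lambda>l. of_bool (X k > X l) - (rank_of n X k - 1) / real n)"
    define S where "S = (\<lambda>\<omega>. \<Sum>s=1..t. active \<omega> k s * g (token \<omega> s k))"
    define C where "C = (\<lambda>\<omega>. active_count \<omega> k t - p * real t)"
    define u where "u = sqrt (real t)"
    have u: "u \<ge> 1" "real t = u\<^sup>2" using t by (auto simp: u_def)
    have hb: "0 \<le> (rank_of n X k - 1) / real n" "(rank_of n X k - 1) / real n \<le> 1"
      using rank_of_bounds[where X = X and n = n and k = k] graph(3) by (auto simp: divide_le_eq)
    have g1: "\<bar>g l\<bar> \<le> 1" for l using hb by (auto simp: g_def)
    have g0: "(\<Sum>l<n. g l) = 0" using graph(3) by (simp add: g_def sum_subtractf rank_of_def)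
    have intS: "integrable (edge_seq n E) (\<lambda>\<omega>. (S \<omega>)\<^sup>2)"
      and S: "(\<integral>\<omega>. (S \<omega>)\<^sup>2 \<partial>edge_seq n E) \<le> D0 * u\<^sup>2"
      using second[OF g1 g0 t] u(2) by (auto simp: S_def)
    have depC: "depends_on {..t} (\<lambda>\<omega>. (C \<omega>)\<^sup>2)"
      unfolding depends_on_def C_def active_count_def active_def by simp
    have bC: "\<bar>C \<omega>\<bar> \<le> real t + p * real t" for \<omega>
    proof -
      have "active_count \<omega> k t \<le> (\<Sum>s=1..t. 1)"
        unfolding active_count_def by (intro sum_mono) (simp add: active_def)
      moreover have "p * real t \<ge> 0" using p by simp
      ultimately show ?thesis using active_count_nonneg[of \<omega> k t] by (simp add: C_def abs_le_iff)
    qed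
    have intC: "integrable (edge_seq n E) (\<lambda>\<omega>. (C \<omega>)\<^sup>2)"
      unfolding edge_seq_eq_iid_seq
    proof (rule depends_on_integrable[OF _ depC])
      show "\<bar>(C \<omega>)\<^sup>2\<bar> \<le> (real t + p * real t)\<^sup>2" for \<omega>
        using power_mono[OF bC[of \<omega>], of 2] by simp
    qed simp
    have C: "(\<integral>\<omega>. (C \<omega>)\<^sup>2 \<partial>edge_seq n E) \<le> u\<^sup>2"
      using active_count_variance[OF graph k, of t] u(2) by (simp add: C_def p_def)
    have "prob_space (edge_seq n E)" unfolding edge_seq_eq_iid_seq by (rule prob_space_iid_seq)
    then interpret prob_space "edge_seq n E" .
    have "(\<integral>\<omega>. \<bar>gorank n X \<omega> k t - rank_of n X k\<bar> \<partial>edge_seq n E) \<le>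
        (\<integral>\<omega>. real n * (((S \<omega>)\<^sup>2 / u + u) / (p * u\<^sup>2) + 4 * (C \<omega>)\<^sup>2 / (p * u\<^sup>2)\<^sup>2) \<partial>edge_seq n E)"
    \<comment> \<open>The rule asks for integrability and nonnegativity of the majorant, the latter
      because a non-integrable left side would have integral 0.\<close>
    proof (rule integral_mono_AE')
      show "AE \<omega> in edge_seq n E. \<bar>gorank n X \<omega> k t - rank_of n X k\<bar> \<le>
          real n * (((S \<omega>)\<^sup>2 / u + u) / (p * u\<^sup>2) + 4 * (C \<omega>)\<^sup>2 / (p * u\<^sup>2)\<^sup>2)"
        using AE_edge_seq[OF graph]
      proof eventually_elim
        fix \<omega> :: "nat \<Rightarrow> edge" assume "\<forall>s. \<omega> s \<in> E"
        from gorank_error_le[OF graph(1) this k graph(3) p t, of X]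
        show "\<bar>gorank n X \<omega> k t - rank_of n X k\<bar> \<le>
          real n * (((S \<omega>)\<^sup>2 / u + u) / (p * u\<^sup>2) + 4 * (C \<omega>)\<^sup>2 / (p * u\<^sup>2)\<^sup>2)"
          unfolding S_def C_def g_def u_def using t by simp
      qed
      show "AE \<omega> in edge_seq n E. 0 \<le> real n * (((S \<omega>)\<^sup>2 / u + u) / (p * u\<^sup>2) + 4 * (C \<omega>)\<^sup>2 / (p * u\<^sup>2)\<^sup>2)"
        using p u(1) by (intro AE_I2 mult_nonneg_nonneg add_nonneg_nonneg divide_nonneg_nonneg) auto
    qed (use intS intC in auto)
    also have "\<dots> = real n * (((\<integral>\<omega>. (S \<omega>)\<^sup>2 \<partial>edge_seq n E) / u + u) / (p * u\<^sup>2)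
        + 4 * (\<integral>\<omega>. (C \<omega>)\<^sup>2 \<partial>edge_seq n E) / (p * u\<^sup>2)\<^sup>2)"
      using intS intC prob_space by simp
    also have "\<dots> \<le> real n * ((D0 * u\<^sup>2 / u + u) / (p * u\<^sup>2) + 4 * u\<^sup>2 / (p * u\<^sup>2)\<^sup>2)"
      using S C p u(1) by (intro mult_left_mono add_mono divide_right_mono) auto
    also have "\<dots> = real n * ((D0 + 1) / p / u + 4 / p\<^sup>2 * (1 / u\<^sup>2))"
      using p u(1) by (simp add: field_simps power2_eq_square)
    also have "\<dots> \<le> real n * ((D0 + 1) / p / u + 4 / p\<^sup>2 * (1 / u))"
    proof -
      have "1 / u\<^sup>2 \<le> 1 / u"
        using u(1) by (intro divide_left_mono) (auto simp: power2_eq_square)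
      then show ?thesis using p by (intro mult_left_mono add_left_mono) auto
    qed
    also have "\<dots> = D / u" using p u(1) by (simp add: D_def field_simps)
    finally show ?thesis by (simp add: u_def)
  qed
  ultimately show ?thesis using that by blast
qed

section \<open>Comparison with \<open>sigma_n\<close> and a constant uniform over graphs\<close>

lemma gorank_eq_1_if_rank_1:
  assumes "simple_graph n E" "\<forall>s. \<omega> s \<in> E" "k < n" and 1: "rank_of n X k = 1"
  shows "gorank n X \<omega> k t = 1"
proof -
  \<comment> \<open>No value lies below \<open>X k\<close>, so every indicator ever averaged is 0.
    Exactness is needed here, as \<open>sigma_n\<close> vanishes at rank 1.\<close>
  have "(\<Sum>l<n. of_bool (X k > X l)) = (0 :: real)"
    using 1 unfolding rank_of_def by linarith
  then have "\<forall>l\<in>{..<n}. of_bool (X k > X l) = (0 :: real)"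
    by (subst (asm) sum_nonneg_eq_0_iff) auto
  moreover have "token \<omega> s k \<in> {..<n}" for s
    using permutes_in_image[OF token_permutes[OF assms(1,2)], of s k] assms(3) by simp
  ultimately have "of_bool (X k > X (token \<omega> s k)) = (0 :: real)" for s by blast
  then show ?thesis unfolding gorank_eq[OF assms(1-3)] by simp
qed

text \<open>The rank lies between 2 and \<open>n\<close>, so both factors under the root in
  \<open>phi\<close> are at least \<open>1 / n\<close>. Hence \<open>phi\<close> is at least
  \<open>1 / n\<close>, while the prefactor is at least \<open>n\<close>.\<close>

lemma sigma_n_ge_1:
  assumes "k < n" "rank_of n X k \<noteq> 1"
  shows "sigma_n n (rank_of n X k) \<ge> 1"
proof -
  obtain l where l: "l < n" "X k > X l"
    using assms(2) by (auto simp: rank_of_def)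
  have "1 \<le> (\<Sum>l<n. of_bool (X k > X l) :: real)"
    using member_le_sum[of l "{..<n}" "\<lambda>l. of_bool (X k > X l) :: real"] l by simp
  then have r: "rank_of n X k \<ge> 2" by (simp add: rank_of_def)
  define v where "v = (rank_of n X k - 1) / real n"
  have n: "real n \<ge> 1" using assms(1) by simp
  have v: "1 / real n \<le> v" "1 / real n \<le> 1 - v"
    using r rank_of_le[OF assms(1), of X] n by (auto simp: v_def field_simps)
  have "v \<ge> 0" using r by (simp add: v_def)
  have "(1 / real n) * (1 / real n) \<le> v * (1 - v)" using v n \<open>v \<ge> 0\<close> by (intro mult_mono) auto
  then have "(1 / real n)\<^sup>2 \<le> v * (1 - v)" by (simp add: power2_eq_square)
  then have "1 / real n \<le> phi v" unfolding phi_def by (rule real_le_rsqrt)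
  moreover have "real n \<le> real n powr (3/2)" using powr_mono[of 1 "3/2" "real n"] n by simp
  ultimately have "real n * (1 / real n) \<le> real n powr (3/2) * phi v" using n by (intro mult_mono) auto
  then show ?thesis using n by (simp add: sigma_n_def v_def)
qed

theorem theorem1:
  fixes n :: nat
  assumes "n \<ge> 2"
  shows "\<exists>K > 0. \<forall>(E :: edge set) (X :: nat \<Rightarrow> real).
    simple_graph n E \<and> connected_graph n E \<and> \<not> bipartite_graph n E \<and> inj_on X {..<n} \<longrightarrow>
    (\<forall>k<n. \<forall>t::nat. t \<ge> 1 \<longrightarrow>
      (\<integral>\<omega>. \<bar>gorank n X \<omega> k t - rank_of n X k\<bar> \<partial>edge_seq n E)
        \<le> K / sqrt (second_smallest_eigenvalue (weighted_laplacian n E) * real t)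
            * sigma_n n (rank_of n X k))"
proof -
  let ?c = "\<lambda>E. second_smallest_eigenvalue (weighted_laplacian n E)"
  \<comment> \<open>The graph conditions stand under the quantifier so that the chosen
    \<open>D\<close> is total and nonnegative, as the sum over all edge sets below requires.\<close>
  have "\<exists>D\<ge>0. simple_graph n E \<and> connected_graph n E \<and> k < n \<longrightarrow> (\<forall>X t. t \<ge> 1 \<longrightarrow>
      (\<integral>\<omega>. \<bar>gorank n X \<omega> k t - rank_of n X k\<bar> \<partial>edge_seq n E) \<le> D / sqrt (real t))" for E k
    using gorank_expected_error[of n E k] assms by (metis order_refl)
  then obtain D where D0: "\<And>E k. D E k \<ge> 0"
    and D: "\<And>E k X t. \<lbrakk>simple_graph n E; connected_graph n E; k < n; t \<ge> 1\<rbrakk> \<Longrightarrow>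
      (\<integral>\<omega>. \<bar>gorank n X \<omega> k t - rank_of n X k\<bar> \<partial>edge_seq n E) \<le> D E k / sqrt (real t)"
    by metis
  let ?G = "Pow ({..<n} \<times> {..<n})"
  \<comment> \<open>\<open>K\<close> dominates \<open>D E k * sqrt c\<close> for each of the
    finitely many edge sets and nodes, so it depends on \<open>n\<close> alone. The absolute value
    keeps the summands nonnegative for edge sets that are not connected graphs, and the added 1
    makes \<open>K\<close> positive.\<close>
  define K where "K = 1 + (\<Sum>E\<in>?G. \<Sum>k<n. D E k * sqrt \<bar>?c E\<bar>)"
  have "K > 0"
    unfolding K_def using D0 by (intro add_pos_nonneg sum_nonneg mult_nonneg_nonneg) auto
  moreover have "(\<integral>\<omega>. \<bar>gorank n X \<omega> k t - rank_of n X k\<bar> \<partial>edge_seq n E)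
        \<le> K / sqrt (?c E * real t) * sigma_n n (rank_of n X k)"
    if graph: "simple_graph n E" "connected_graph n E" and k: "k < n" and t: "t \<ge> 1" for E X k and t :: nat
  proof (cases "rank_of n X k = 1")
    case True
    have "(\<integral>\<omega>. \<bar>gorank n X \<omega> k t - rank_of n X k\<bar> \<partial>edge_seq n E) = 0"
    proof (rule integral_eq_zero_AE)
      show "AE \<omega> in edge_seq n E. \<bar>gorank n X \<omega> k t - rank_of n X k\<bar> = 0"
        using AE_edge_seq[OF graph assms]
        by eventually_elim (use gorank_eq_1_if_rank_1[OF graph(1) _ k True] True in auto)
    qed
    then show ?thesis by (simp add: True sigma_n_def phi_def)
  next
    case False
    have c: "?c E > 0" using second_smallest_eigenvalue_weighted_laplacian_pos[OF graph assms] .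
    have EG: "E \<in> ?G" using graph(1) by (auto simp: simple_graph_def)
    have "D E k * sqrt \<bar>?c E\<bar> \<le> (\<Sum>k<n. D E k * sqrt \<bar>?c E\<bar>)"
      using k D0 by (intro member_le_sum) auto
    also have "\<dots> \<le> (\<Sum>E\<in>?G. \<Sum>k<n. D E k * sqrt \<bar>?c E\<bar>)"
      using EG D0 by (intro member_le_sum[of E ?G "\<lambda>E. \<Sum>k<n. D E k * sqrt \<bar>?c E\<bar>"]) (auto intro!: sum_nonneg)
    finally have DK: "D E k * sqrt (?c E) \<le> K" using c by (simp add: K_def)
    have "(\<integral>\<omega>. \<bar>gorank n X \<omega> k t - rank_of n X k\<bar> \<partial>edge_seq n E) \<le> D E k / sqrt (real t)"
      by (rule D[OF graph k t])
    \<comment> \<open>Positivity of the eigenvalue allows inserting its root into numerator and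
      denominator.\<close>
    also have "\<dots> = D E k * sqrt (?c E) / sqrt (?c E * real t)"
      using c by (simp add: real_sqrt_mult)
    also have "\<dots> \<le> K / sqrt (?c E * real t)"
      using DK c by (intro divide_right_mono) auto
    also have "\<dots> \<le> K / sqrt (?c E * real t) * sigma_n n (rank_of n X k)"
      using mult_left_mono[OF sigma_n_ge_1[OF k False], of "K / sqrt (?c E * real t)"] \<open>K > 0\<close> c by simp
    finally show ?thesis .
  qed
  ultimately show ?thesis by blast
qed

end
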